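(* Let $t\geq2$ and $n\geq 400t$ be integers. If $\mathcal{F},\mathcal{G}\subseteq S_n$ are cross $t$-intersecting, then $$\min\{\gamma_t(\mathcal{F}),\gamma_t(\mathcal{G})\}\leq t\big((n-t-1)!-(n-t-2)!\big).$$ If equality holds, then $\mathcal{F},\mathcal{G}\subseteq\mathcal{H}$ for some $\mathcal{H}\subseteq S_n$ with $\mathcal H\cong\mathcal{F}_1(n,t)$.
   Context: $S_n$ is the symmetric group on $[n]=\{1,\dots,n\}$. Two families $\mathcal F,\mathcal G\subseteq S_n$ are cross $t$-intersecting if every $\sigma\in\mathcal F$ and $\tau\in\mathcal G$ agree on at least $t$ points of $[n]$. A permutation $\sigma\in S_n$ is identified with the set $\{(i,\sigma(i)):i\in[n]\}\subseteq[n]^2$. For a family $\mathcal F\subseteq S_n$, its maximum $t$-degree is $\Delta_t(\mathcal F)=\max_{S\subseteq[n]^2,\,|S|=t}|\{\sigma\in\mathcal F:S\subseteq\sigma\}|$, and its $t$-diversity is $\gamma_t(\mathcal F)=|\mathcal F|-\Delta_t(\mathcal F)$; equivalently, $\gamma_t(\mathcal F)=\min_{\mathcal C}|\mathcal F\setminus\mathcal C|$ over all $t$-cosets $\mathcal C$ (sets of the form $\{\sigma\in S_n:\sigma(i_k)=j_k,\ k=1,\dots,t\}$ with distinct $i_k$ and distinct $j_k$). Families $\mathcal F_1,\mathcal F_2\subseteq S_n$ are isomorphic, $\mathcal F_1\cong\mathcal F_2$, if $\mathcal F_2=\{\rho\sigma\pi:\sigma\in\mathcal F_1\}$ for some $\rho,\pi\in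 S_n$. Define $$\mathcal F_1(n,t)=\{\sigma\in S_n:|\{j\in[t+2]:\sigma(j)=j\}|\geq t+1\}.$$ *)

theory Defs
  imports "HOL-Combinatorics.Permutations"
begin

text \<open>A permutation of \<open>{1..n}\<close> is a function \<open>nat \<Rightarrow> nat\<close> with \<open>\<sigma> permutes {1..n}\<close>; it is
  the identity outside \<open>{1..n}\<close>, so distinct functions are distinct elements of \<open>S\<^sub>n\<close>.\<close>

definition Sym :: "nat \<Rightarrow> (nat \<Rightarrow> nat) set" where
  "Sym n = {\<sigma>. \<sigma> permutes {1..n}}"

definition cross_intersecting ::
  "nat \<Rightarrow> nat \<Rightarrow> (nat \<Rightarrow> nat) set \<Rightarrow> (nat \<Rightarrow> nat) set \<Rightarrow> bool" where
  "cross_intersecting n t F G \<longleftrightarrow>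
     (\<forall>\<sigma>\<in>F. \<forall>\<tau>\<in>G. t \<le> card {i \<in> {1..n}. \<sigma> i = \<tau> i})"

definition perm_graph :: "nat \<Rightarrow> (nat \<Rightarrow> nat) \<Rightarrow> (nat \<times> nat) set" where
  "perm_graph n \<sigma> = {(i, \<sigma> i) | i. i \<in> {1..n}}"

text \<open>For \<open>t \<le> n\<^sup>2\<close> the maximum is over a finite nonempty set.\<close>

definition max_degree :: "nat \<Rightarrow> nat \<Rightarrow> (nat \<Rightarrow> nat) set \<Rightarrow> nat" where
  "max_degree n t F =
     Max ((\<lambda>S. card {\<sigma> \<in> F. S \<subseteq> perm_graph n \<sigma>})
          ` {S. S \<subseteq> {1..n} \<times> {1..n} \<and> card S = t})"

text \<open>For \<open>F \<subseteq> Sym n\<close> and \<open>t \<le> n\<^sup>2\<close>, \<open>max_degree n t F \<le> card F\<close>, so the subtraction on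
  \<open>nat\<close> does not truncate.\<close>

definition diversity :: "nat \<Rightarrow> nat \<Rightarrow> (nat \<Rightarrow> nat) set \<Rightarrow> nat" where
  "diversity n t F = card F - max_degree n t F"

definition isomorphic_families ::
  "nat \<Rightarrow> (nat \<Rightarrow> nat) set \<Rightarrow> (nat \<Rightarrow> nat) set \<Rightarrow> bool" where
  "isomorphic_families n A B \<longleftrightarrow>
     (\<exists>\<rho>\<in>Sym n. \<exists>\<pi>\<in>Sym n. B = {\<rho> \<circ> \<sigma> \<circ> \<pi> | \<sigma>. \<sigma> \<in> A})"

definition F1 :: "nat \<Rightarrow> nat \<Rightarrow> (nat \<Rightarrow> nat) set" where
  "F1 n t = {\<sigma> \<in> Sym n. card {j \<in> {1..t+2}. \<sigma> j = j} \<ge> t + 1}"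

end

theory Submission imports Defs Complex_Main begin

text \<open>
  Write \<open>N = n - t\<close> and \<open>D = t * ((N - 1)! - (N - 2)!)\<close>. Identify a permutation with its graph, a set of
  cells in an \<open>n \<times> n\<close> board. It suffices to show that two cross \<open>t\<close>-intersecting families \<open>F\<close> and
  \<open>G\<close> of diversity at least \<open>D\<close> each lie in a common family \<open>H\<close> of all permutations that contain at
  least \<open>t + 1\<close> of the cells of some partial permutation \<open>T\<close> of size \<open>t + 2\<close>: this \<open>H\<close> is isomorphic to
  \<open>F1 n t\<close>, and its subfamilies have diversity at most \<open>D\<close>.

  The first idea is that \<open>F\<close> is almost a union of cosets of small sets of cells. Call a set of cells a
  cover if it meets every member of \<open>G\<close> in \<open>t\<close> cells. A member of \<open>F\<close> is a cover of full size \<open>n\<close>; small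
  covers are to be found inside it. As long as the part of \<open>\<sigma> \<in> F\<close> known so far is not a cover, some
  \<open>\<tau> \<in> G\<close> meets it in fewer than \<open>t\<close> cells, so \<open>\<sigma>\<close> must agree with \<open>\<tau>\<close> somewhere else. A random
  permutation fails to do so with probability about \<open>1 / e\<close>, whatever \<open>\<tau>\<close> is and with little regard to the
  answers to earlier questions (\<open>card_hitting_le\<close>, by a switching argument). Hence each question
  eliminates a constant fraction of all permutations, and after \<open>n div 10\<close> questions only a negligible
  number of permutations remains (\<open>uncovered_branching\<close>, \<open>card_uncovered\<close>). Doing this for both families gives systems \<open>\<A>\<close> and \<open>\<B>\<close> of sets of
  size at most \<open>t + n div 10\<close> such that every \<open>A \<in> \<A>\<close> meets every \<open>B \<in> \<B>\<close> in at least \<open>t\<close> cells,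
  and such that they span almost all of \<open>F\<close> and \<open>G\<close> (\<open>approximate_both\<close>).

  The second idea is that large covers can be discarded. If all sets in \<open>\<B>\<close> have size at most \<open>t + c\<close>,
  there are at most \<open>(t + c choose t) * (c + 1) ^ c\<close> minimal covers of \<open>\<B>\<close> of size \<open>t + c\<close>
  (\<open>card_min_covers\<close>), and each of them spans at most \<open>(N - c)!\<close> permutations. Lowering \<open>c\<close> one by one, down
  to \<open>1\<close>, costs a geometric sum that is dominated by its last term, which is small compared with \<open>D\<close>
  because \<open>n \<ge> 400 * t\<close> (\<open>peel\<close>, \<open>peel_bound\<close>).

  What remains is finite combinatorics. Diversity excludes sets of size \<open>t\<close>, and it forces every \<open>t\<close>-set to
  be missed by at least two members of \<open>\<A>\<close> and of \<open>\<B>\<close>; such cross \<open>t\<close>-intersecting systems of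
  \<open>(t + 1)\<close>-sets live on a common set \<open>T\<close> of \<open>t + 2\<close> cells (\<open>confined_to_core\<close>). Finally, \<open>F\<close> must
  fill most of the cosets of at least three of the sets \<open>T - {y}\<close>, and then no member of \<open>G\<close> can contain
  fewer than \<open>t + 1\<close> cells of \<open>T\<close>; the same holds with \<open>F\<close> and \<open>G\<close> exchanged
  (\<open>transversal_of_dense_cosets\<close>). So the approximate description is in fact exact.
\<close>

section \<open>Cosets\<close>

text \<open>For a set \<open>B\<close> of cells, the permutations whose graph contains \<open>B\<close>; when
\<open>B\<close> has \<open>t\<close> cells no two of which share a row or a column, this is a \<open>t\<close>-coset.\<close>
definition coset :: "nat \<Rightarrow> (nat \<times> nat) set \<Rightarrow> (nat \<Rightarrow> nat) set" where
  "coset n B = {\<sigma> \<in> Sym n. B \<subseteq> perm_graph n \<sigma>}"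

lemma mem_perm_graph: "(i, j) \<in> perm_graph n \<sigma> \<longleftrightarrow> i \<in> {1..n} \<and> j = \<sigma> i"
  by (auto simp: perm_graph_def)

lemma finite_Sym: "finite (Sym n)"
  unfolding Sym_def by (rule finite_permutations) simp

lemma finite_coset: "finite (coset n B)"
  unfolding coset_def using finite_Sym by simp

lemma finite_perm_graph: "finite (perm_graph n \<sigma>)"
proof -
  have "perm_graph n \<sigma> = (\<lambda>i. (i, \<sigma> i)) ` {1..n}" by (auto simp: perm_graph_def)
  thus ?thesis by simp
qed

lemma perm_graph_subset: "\<sigma> \<in> Sym n \<Longrightarrow> perm_graph n \<sigma> \<subseteq> {1..n} \<times> {1..n}"
  unfolding Sym_def perm_graph_def using permutes_in_image by fastforce

lemma card_perm_graph_Int: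
  "card (perm_graph n \<sigma> \<inter> perm_graph n \<tau>) = card {i \<in> {1..n}. \<sigma> i = \<tau> i}"
proof -
  have "perm_graph n \<sigma> \<inter> perm_graph n \<tau> = (\<lambda>i. (i, \<sigma> i)) ` {i \<in> {1..n}. \<sigma> i = \<tau> i}"
    by (auto simp: perm_graph_def)
  moreover have "inj_on (\<lambda>i. (i, \<sigma> i)) {i \<in> {1..n}. \<sigma> i = \<tau> i}" by (auto simp: inj_on_def)
  ultimately show ?thesis by (simp only: card_image)
qed

lemma card_rows: assumes "B \<subseteq> perm_graph n \<sigma>" shows "card (fst ` B) = card B"
proof -
  have "inj_on fst (perm_graph n \<sigma>)" by (auto simp: inj_on_def perm_graph_def)
  hence "inj_on fst B" using assms by (rule inj_on_subset)
  thus ?thesis by (rule card_image)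
qed

text \<open>Left multiplication by the inverse of \<open>\<sigma>\<close> turns the permutations that agree with \<open>\<sigma>\<close> on the
rows of \<open>B\<close> into the permutations of the remaining rows.\<close>
lemma card_coset:
  assumes "B \<subseteq> perm_graph n \<sigma>" "\<sigma> \<in> Sym n"
  shows "card (coset n B) = fact (n - card B)"
proof -
  let ?R = "{1..n} - fst ` B"
  have s: "\<sigma> permutes {1..n}" using assms(2) by (simp add: Sym_def)
  have rows: "fst ` B \<subseteq> {1..n}" using assms(1) by (auto simp: perm_graph_def)
  have "coset n B = (\<lambda>\<pi>. \<sigma> \<circ> \<pi>) ` {\<pi>. \<pi> permutes ?R}"
  proof (intro set_eqI iffI)
    fix \<rho> assume r: "\<rho> \<in> coset n B"
    have rp: "\<rho> permutes {1..n}" using r by (simp add: coset_def Sym_def)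
    define \<pi> where "\<pi> = inv \<sigma> \<circ> \<rho>"
    have "\<pi> permutes {1..n}" unfolding \<pi>_def
      by (rule permutes_compose[OF rp permutes_inv[OF s]])
    moreover have "\<pi> i = i" if "i \<in> fst ` B" for i
    proof -
      obtain j where "(i, j) \<in> B" using \<open>i \<in> fst ` B\<close> by auto
      hence "j = \<sigma> i" "j = \<rho> i" using assms(1) r by (auto simp: coset_def perm_graph_def)
      hence "\<rho> i = \<sigma> i" by simp
      thus ?thesis unfolding \<pi>_def using permutes_inverses(2)[OF s] by simp
    qed
    ultimately have "\<pi> permutes ?R" unfolding permutes_def by auto
    moreover have "\<rho> = \<sigma> \<circ> \<pi>" unfolding \<pi>_def using s
      by (simp add: comp_assoc[symmetric] permutes_inv_o)
    ultimately show "\<rho> \<in> (\<lambda>\<pi>. \<sigma> \<circ> \<pi>) ` {\<pi>. \<pi> permutes ?R}" by blast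
  next
    fix \<rho> assume "\<rho> \<in> (\<lambda>\<pi>. \<sigma> \<circ> \<pi>) ` {\<pi>. \<pi> permutes ?R}"
    then obtain \<pi> where p: "\<pi> permutes ?R" "\<rho> = \<sigma> \<circ> \<pi>" by blast
    have "\<pi> permutes {1..n}" using p(1) by (rule permutes_subset) auto
    hence "\<rho> permutes {1..n}" using p(2) permutes_compose s by blast
    moreover have "B \<subseteq> perm_graph n \<rho>"
    proof
      fix x assume x: "x \<in> B"
      obtain i j where ij: "x = (i, j)" by fastforce
      have "i \<in> fst ` B" using x ij by force
      hence "\<pi> i = i" using p(1) unfolding permutes_def by auto
      thus "x \<in> perm_graph n \<rho>" using x ij assms(1) p(2) by (auto simp: mem_perm_graph)
    qed
    ultimately show "\<rho> \<in> coset n B" by (simp add: coset_def Sym_def)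
  qed
  moreover have "inj_on (\<lambda>\<pi>. \<sigma> \<circ> \<pi>) {\<pi>. \<pi> permutes ?R}"
  proof (rule inj_onI)
    fix \<pi> \<pi>' assume "\<sigma> \<circ> \<pi> = \<sigma> \<circ> \<pi>'"
    hence "inv \<sigma> \<circ> \<sigma> \<circ> \<pi> = inv \<sigma> \<circ> \<sigma> \<circ> \<pi>'" by (simp only: comp_assoc)
    thus "\<pi> = \<pi>'" by (simp add: permutes_inv_o[OF s])
  qed
  ultimately have "card (coset n B) = card {\<pi>. \<pi> permutes ?R}" by (simp add: card_image)
  also have "\<dots> = fact (card ?R)" by (rule card_permutations) auto
  also have "card ?R = n - card B"
    using card_Diff_subset[of "fst ` B" "{1..n}"] rows card_rows[OF assms(1)]
    by (simp add: finite_subset)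
  finally show ?thesis .
qed

lemma card_coset_le: "card (coset n B) \<le> fact (n - card B)"
proof (cases "coset n B = {}")
  case False
  then obtain \<sigma> where "\<sigma> \<in> Sym n" "B \<subseteq> perm_graph n \<sigma>" by (auto simp: coset_def)
  thus ?thesis using card_coset by fastforce
qed simp

section \<open>Avoiding a permutation by switching\<close>
definition avoiding_coset ::
  "nat \<Rightarrow> (nat \<times> nat) set \<Rightarrow> (nat \<times> nat) set \<Rightarrow> (nat \<Rightarrow> nat) set" where
  "avoiding_coset n B Z = {\<sigma> \<in> coset n B. perm_graph n \<sigma> \<inter> Z = {}}"

definition line_bounded :: "nat \<Rightarrow> nat \<Rightarrow> (nat \<times> nat) set \<Rightarrow> bool" where
  "line_bounded n s Z \<longleftrightarrow> (\<forall>i\<in>{1..n}. card {j \<in> {1..n}. (i, j) \<in> Z} \<le> s)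
      \<and> (\<forall>j\<in>{1..n}. card {i \<in> {1..n}. (i, j) \<in> Z} \<le> s)"

lemma finite_avoiding: "finite (avoiding_coset n B Z)"
  unfolding avoiding_coset_def using finite_coset by simp

text \<open>If \<open>\<sigma>\<close> agrees with \<open>\<tau>\<close> in row \<open>i\<close>, exchanging the values of \<open>\<sigma>\<close> in the rows \<open>i\<close> and \<open>k\<close>
destroys this agreement. At most \<open>2 * s\<close> of the free rows \<open>k\<close> are spoiled by \<open>Z\<close>; the agreements with
\<open>\<tau>\<close> that were avoided before stay avoided, because the value \<open>\<tau> i\<close> moved to row \<open>k\<close> differs from
\<open>\<tau> k\<close>. The pair \<open>(\<sigma>, k)\<close> can be read off from the result, since \<open>k\<close> is the row in which the value
\<open>\<tau> i\<close> now stands. Hence agreement in row \<open>i\<close> has probability at most about \<open>1 / (n - card B)\<close>,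
even conditionally on avoiding \<open>Z\<close>.\<close>
lemma switching:
  fixes n s :: nat
  assumes Z: "line_bounded n s Z" and \<tau>: "\<tau> \<in> Sym n"
    and i: "i \<in> {1..n} - fst ` B" and R': "i \<notin> R'"
    and B: "coset n B \<noteq> {}"
  defines "Y \<equiv> {\<sigma> \<in> avoiding_coset n B Z. \<forall>k\<in>R'. \<sigma> k \<noteq> \<tau> k}"
  shows "(n - card B - 2 * s) * card {\<sigma> \<in> Y. \<sigma> i = \<tau> i} \<le> card Y"
proof -
  let ?R = "{1..n} - fst ` B"
  let ?P = "{\<sigma> \<in> Y. \<sigma> i = \<tau> i}"
  define good :: "(nat \<Rightarrow> nat) \<Rightarrow> nat set" where "good \<sigma> = {k \<in> ?R. (k, \<tau> i) \<notin> Z \<and> (i, \<sigma> k) \<notin> Z}" for \<sigma>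
  define f :: "(nat \<Rightarrow> nat) \<times> nat \<Rightarrow> nat \<Rightarrow> nat"
    where "f = (\<lambda>(\<sigma>, k). \<sigma> \<circ> transpose i k)"
  have finY: "finite Y" unfolding Y_def using finite_avoiding by simp
  have Rc: "card ?R = n - card B"
  proof -
    obtain \<rho> where r: "B \<subseteq> perm_graph n \<rho>" using B by (auto simp: coset_def)
    hence "fst ` B \<subseteq> {1..n}" by (auto simp: perm_graph_def)
    thus ?thesis
      using card_Diff_subset[of "fst ` B" "{1..n}"] card_rows[OF r] by (simp add: finite_subset)
  qed
  have \<tau>p: "\<tau> permutes {1..n}" using \<tau> by (simp add: Sym_def)
  have iin: "i \<in> {1..n}" using i by blast
  have \<tau>i: "\<tau> i \<in> {1..n}" using permutes_in_image[OF \<tau>p] iin by blast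
  have goodc: "n - card B - 2 * s \<le> card (good \<sigma>)" if "\<sigma> \<in> ?P" for \<sigma>
  proof -
    have sp: "\<sigma> permutes {1..n}"
      using that by (simp add: Y_def avoiding_coset_def coset_def Sym_def)
    let ?b1 = "{k \<in> {1..n}. (k, \<tau> i) \<in> Z}"
    let ?b2 = "{k \<in> {1..n}. (i, \<sigma> k) \<in> Z}"
    have "card ?b1 \<le> s" using Z \<tau>i unfolding line_bounded_def by blast
    moreover have "card ?b2 \<le> s"
    proof -
      have "card ?b2 = card (\<sigma> ` ?b2)"
        using permutes_inj_on[OF sp] by (simp add: card_image)
      also have "\<dots> \<le> card {j \<in> {1..n}. (i, j) \<in> Z}"
        by (rule card_mono) (use permutes_in_image[OF sp] in auto)
      also have "\<dots> \<le> s" using Z iin unfolding line_bounded_def by blast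
      finally show ?thesis .
    qed
    ultimately have "card (?b1 \<union> ?b2) \<le> 2 * s"
      using card_Un_le[of ?b1 ?b2] by linarith
    moreover have "card ?R - card (?b1 \<union> ?b2) \<le> card (?R - (?b1 \<union> ?b2))"
      by (rule diff_card_le_card_Diff) simp
    moreover have "card (?R - (?b1 \<union> ?b2)) \<le> card (good \<sigma>)"
      by (rule card_mono) (auto simp: good_def)
    ultimately show ?thesis using Rc by linarith
  qed
  have inj: "inj_on f (SIGMA \<sigma>:?P. good \<sigma>)"
  proof (rule inj_onI, clarify)
    fix \<sigma> k \<sigma>' k'
    assume P: "\<sigma> \<in> Y" "\<sigma> i = \<tau> i" "\<sigma>' \<in> Y" "\<sigma>' i = \<tau> i"
      and e: "f (\<sigma>, k) = f (\<sigma>', k')"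
    have inj\<sigma>: "inj (\<sigma>' \<circ> transpose i k')"
    proof -
      have "\<sigma>' permutes {1..n}" using P by (simp add: Y_def avoiding_coset_def coset_def Sym_def)
      thus ?thesis by (simp add: inj_compose permutes_inj)
    qed
    have e': "\<sigma> \<circ> transpose i k = \<sigma>' \<circ> transpose i k'" using e by (simp add: f_def)
    have "(\<sigma>' \<circ> transpose i k') k = \<tau> i" using P e' by (metis comp_apply transpose_apply_second)
    moreover have "(\<sigma>' \<circ> transpose i k') k' = \<tau> i" using P by simp
    ultimately have "k = k'" using inj\<sigma> by (metis injD)
    moreover from this e' have "\<sigma> = \<sigma>'"
      by (metis comp_assoc comp_id transpose_comp_involutory)
    ultimately show "\<sigma> = \<sigma>' \<and> k = k'" by simp
  qed
  have img: "f ` (SIGMA \<sigma>:?P. good \<sigma>) \<subseteq> Y"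
  proof clarify
    fix \<sigma> k assume s: "\<sigma> \<in> Y" "\<sigma> i = \<tau> i" and k: "k \<in> good \<sigma>"
    let ?r = "\<sigma> \<circ> transpose i k"
    have sp: "\<sigma> permutes {1..n}" and sB: "B \<subseteq> perm_graph n \<sigma>"
      and sZ: "perm_graph n \<sigma> \<inter> Z = {}" and sR: "\<forall>k\<in>R'. \<sigma> k \<noteq> \<tau> k"
      using s by (auto simp: Y_def avoiding_coset_def coset_def Sym_def)
    have kR: "k \<in> {1..n}" "k \<notin> fst ` B" using k by (auto simp: good_def)
    have "?r permutes {1..n}"
      using permutes_compose[OF permutes_swap_id sp] iin kR by blast
    moreover have "B \<subseteq> perm_graph n ?r"
    proof
      fix x assume x: "x \<in> B"
      obtain a b where ab: "x = (a, b)" by fastforce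
      have "a \<in> fst ` B" using x ab by force
      hence "a \<noteq> i" "a \<noteq> k" using i kR by auto
      thus "x \<in> perm_graph n ?r" using sB x ab by (auto simp: mem_perm_graph)
    qed
    moreover have "perm_graph n ?r \<inter> Z = {}"
    proof -
      have "(a, ?r a) \<notin> Z" if "a \<in> {1..n}" for a
      proof -
        have "(a, \<sigma> a) \<notin> Z" using sZ that by (auto simp: perm_graph_def)
        thus ?thesis using k s(2) by (auto simp: good_def transpose_def)
      qed
      thus ?thesis by (auto simp: perm_graph_def)
    qed
    moreover have "\<forall>a\<in>R'. ?r a \<noteq> \<tau> a"
    proof
      fix a assume a: "a \<in> R'"
      hence "a \<noteq> i" using R' by blast
      show "?r a \<noteq> \<tau> a"
      proof (cases "a = k")
        case True
        have "\<tau> i \<noteq> \<tau> a" using \<open>a \<noteq> i\<close> permutes_inj[OF \<tau>p] by (metis injD)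
        thus ?thesis using True s(2) by simp
      next
        case False
        thus ?thesis using \<open>a \<noteq> i\<close> sR a by simp
      qed
    qed
    ultimately show "f (\<sigma>, k) \<in> Y"
      by (simp add: f_def Y_def avoiding_coset_def coset_def Sym_def)
  qed
  have finP: "finite ?P" using finY by simp
  have "(n - card B - 2 * s) * card ?P = (\<Sum>\<sigma>\<in>?P. n - card B - 2 * s)" by simp
  also have "\<dots> \<le> (\<Sum>\<sigma>\<in>?P. card (good \<sigma>))" by (rule sum_mono) (rule goodc)
  also have "\<dots> = card (SIGMA \<sigma>:?P. good \<sigma>)"
    by (rule card_SigmaI[symmetric]) (use finP in \<open>auto simp: good_def\<close>)
  also have "\<dots> = card (f ` (SIGMA \<sigma>:?P. good \<sigma>))" by (rule card_image[OF inj, symmetric])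
  also have "\<dots> \<le> card Y" by (rule card_mono[OF finY img])
  finally show ?thesis .
qed

text \<open>The rows are avoided one after the other, and each of them costs one application of switching.\<close>
lemma avoid_rows:
  fixes n s :: nat
  assumes Z: "line_bounded n s Z" and \<tau>: "\<tau> \<in> Sym n" and B: "coset n B \<noteq> {}"
    and q: "q = n - card B - 2 * s" "q > 0"
    and R': "finite R'" "R' \<subseteq> {1..n} - fst ` B"
  shows "(1 - 1 / real q) ^ card R' * card (avoiding_coset n B Z)
       \<le> card {\<sigma> \<in> avoiding_coset n B Z. \<forall>k\<in>R'. \<sigma> k \<noteq> \<tau> k}"
  using R'
proof (induction R' rule: finite_induct)
  case empty
  show ?case by simp
next
  case (insert i R')
  let ?Y = "{\<sigma> \<in> avoiding_coset n B Z. \<forall>k\<in>R'. \<sigma> k \<noteq> \<tau> k}"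
  let ?Y' = "{\<sigma> \<in> avoiding_coset n B Z. \<forall>k\<in>insert i R'. \<sigma> k \<noteq> \<tau> k}"
  let ?P = "{\<sigma> \<in> ?Y. \<sigma> i = \<tau> i}"
  have fin: "finite ?Y" using finite_avoiding by simp
  have sw: "q * card ?P \<le> card ?Y"
    using switching[OF Z \<tau> _ insert.hyps(2) B, of] insert.prems q(1) by blast
  have Y: "?Y = ?Y' \<union> ?P" by auto
  have "card ?Y = card (?Y' \<union> ?P)" using Y by (rule arg_cong)
  also have "\<dots> = card ?Y' + card ?P"
    by (rule card_Un_disjoint) (use finite_avoiding in auto)
  finally have "card ?Y = card ?Y' + card ?P" .
  moreover have "real (card ?P) \<le> card ?Y / q"
  proof -
    have "real (q * card ?P) \<le> real (card ?Y)" using sw by (simp only: of_nat_le_iff)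
    hence "real q * card ?P \<le> card ?Y" by (simp only: of_nat_mult)
    thus ?thesis using q(2) by (simp add: field_simps)
  qed
  ultimately have "real (card ?Y) - card ?Y / q \<le> card ?Y'" by linarith
  hence y: "(1 - 1 / real q) * card ?Y \<le> card ?Y'" by (simp only: left_diff_distrib) simp
  have "0 \<le> 1 - 1 / real q" using q(2) by simp
  hence "(1 - 1 / real q) * ((1 - 1 / real q) ^ card R' * card (avoiding_coset n B Z))
      \<le> (1 - 1 / real q) * card ?Y"
    using insert by (intro mult_left_mono) auto
  thus ?case using y insert.hyps by (simp add: mult.assoc)
qed

text \<open>The power is roughly \<open>exp (- r / q)\<close>, so the bound rests on \<open>exp (4 / 3) \<le> 4\<close>.\<close>
lemma quarter_le_power:
  fixes q r :: nat
  assumes "3 * r \<le> 4 * (q - 1)" "q \<ge> 2"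
  shows "1 / 4 \<le> (1 - 1 / real q) ^ r"
proof -
  have q1: "real q - 1 > 0" using assms by simp
  have "(1 + 1 / (real q - 1)) ^ r \<le> exp (1 / (real q - 1)) ^ r"
    by (rule power_mono) (use q1 exp_ge_add_one_self in auto)
  also have "\<dots> = exp (r / (real q - 1))" by (simp add: exp_of_nat_mult[symmetric])
  also have "\<dots> \<le> exp (4 / 3)"
  proof -
    have "3 * r + 4 \<le> 4 * q" using assms by linarith
    hence "real (3 * r + 4) \<le> real (4 * q)" by (simp only: of_nat_le_iff)
    hence "3 * real r \<le> 4 * (real q - 1)" by simp
    hence "r / (real q - 1) \<le> 4 / 3" using q1 by (simp add: field_simps)
    thus ?thesis by simp
  qed
  \<comment> \<open>The quadratic bound on \<open>exp\<close> is sharp enough at \<open>1 / 12\<close>, but not at \<open>1 / 3\<close> or \<open>1 / 6\<close>.\<close>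
  also have "exp (4 / 3) = exp (1 / 12 :: real) ^ 16" by (simp add: exp_of_nat_mult[symmetric])
  also have "\<dots> \<le> (1 + 1 / 12 + (1 / 12)\<^sup>2) ^ 16"
    by (rule power_mono) (use exp_bound[of "1 / 12"] in simp_all)
  also have "\<dots> \<le> (4 :: real)" by (simp add: power2_eq_square power_divide)
  finally have u: "(1 + 1 / (real q - 1)) ^ r \<le> 4" .
  have "(1 - 1 / real q) * (1 + 1 / (real q - 1)) = 1" using q1 by (simp add: field_simps)
  hence "(1 - 1 / real q) ^ r * (1 + 1 / (real q - 1)) ^ r = 1"
    by (metis power_mult_distrib power_one)
  moreover have "0 \<le> (1 - 1 / real q) ^ r" using assms by (intro zero_le_power) simp
  ultimately have "1 \<le> (1 - 1 / real q) ^ r * 4"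
    using mult_left_mono[OF u] by metis
  thus ?thesis by simp
qed

text \<open>A random permutation misses a given permutation with probability about \<open>1 / e\<close>. The point is that
a constant amount of this survives the conditions that \<open>B\<close> is contained and that \<open>Z\<close> is avoided.\<close>
lemma card_hitting_le:
  fixes n s :: nat
  assumes Z: "line_bounded n s Z" and \<tau>: "\<tau> \<in> Sym n"
    and q: "3 * (n - card B) \<le> 4 * (n - card B - 2 * s - 1)" "card B + 2 * s + 2 \<le> n"
  shows "card {\<sigma> \<in> avoiding_coset n B Z. \<exists>i\<in>{1..n} - fst ` B. \<sigma> i = \<tau> i}
       \<le> 3 / 4 * card (avoiding_coset n B Z)"
proof (cases "coset n B = {}")
  case True
  thus ?thesis by (simp add: avoiding_coset_def)
next
  case False
  let ?R = "{1..n} - fst ` B"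
  let ?X = "avoiding_coset n B Z"
  let ?N = "{\<sigma> \<in> ?X. \<forall>k\<in>?R. \<sigma> k \<noteq> \<tau> k}"
  let ?H = "{\<sigma> \<in> ?X. \<exists>i\<in>?R. \<sigma> i = \<tau> i}"
  obtain \<rho> where r: "B \<subseteq> perm_graph n \<rho>" using False by (auto simp: coset_def)
  hence "fst ` B \<subseteq> {1..n}" by (auto simp: perm_graph_def)
  hence Rc: "card ?R = n - card B"
    using card_Diff_subset[of "fst ` B" "{1..n}"] card_rows[OF r] by (simp add: finite_subset)
  have "1 / 4 \<le> (1 - 1 / real (n - card B - 2 * s)) ^ card ?R"
    unfolding Rc by (rule quarter_le_power) (use q in linarith)+
  hence "1 / 4 * card ?X \<le> (1 - 1 / real (n - card B - 2 * s)) ^ card ?R * card ?X"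
    by (rule mult_right_mono) simp
  also have "\<dots> \<le> card ?N"
    by (rule avoid_rows[OF Z \<tau> False refl]) (use q in auto)
  finally have a: "1 / 4 * card ?X \<le> card ?N" .
  have X: "?X = ?N \<union> ?H" by auto
  have "card ?X = card (?N \<union> ?H)" using X by (rule arg_cong)
  also have "\<dots> = card ?N + card ?H"
    by (rule card_Un_disjoint) (use finite_avoiding in auto)
  finally have "card ?X = card ?N + card ?H" .
  thus ?thesis using a by simp
qed

section \<open>Approximation by small covers\<close>
definition t_cover :: "nat \<Rightarrow> 'a set set \<Rightarrow> 'a set \<Rightarrow> bool" where
  "t_cover t \<T> A \<longleftrightarrow> (\<forall>B\<in>\<T>. t \<le> card (A \<inter> B))"

lemma line_bounded_extend:
  assumes Z: "line_bounded n s Z" and \<tau>: "\<tau> \<in> Sym n"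
  shows "line_bounded n (Suc s) (Z \<union> {(k, \<tau> k) |k. k \<in> K})"
  unfolding line_bounded_def
proof (intro conjI ballI)
  let ?Z = "Z \<union> {(k, \<tau> k) |k. k \<in> K}"
  fix i assume i: "i \<in> {1..n}"
  have "card {j \<in> {1..n}. (i, j) \<in> ?Z} \<le> card (insert (\<tau> i) {j \<in> {1..n}. (i, j) \<in> Z})"
    by (rule card_mono) auto
  also have "\<dots> \<le> Suc (card {j \<in> {1..n}. (i, j) \<in> Z})" by (rule card_insert_le_m1) auto
  also have "\<dots> \<le> Suc s" using Z i by (simp add: line_bounded_def)
  finally show "card {j \<in> {1..n}. (i, j) \<in> ?Z} \<le> Suc s" .
next
  let ?Z = "Z \<union> {(k, \<tau> k) |k. k \<in> K}"
  fix j assume j: "j \<in> {1..n}"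
  have \<tau>p: "\<tau> permutes {1..n}" using \<tau> by (simp add: Sym_def)
  have "i = inv \<tau> j" if "j = \<tau> i" for i using that permutes_inverses(2)[OF \<tau>p] by simp
  hence "card {i \<in> {1..n}. (i, j) \<in> ?Z} \<le> card (insert (inv \<tau> j) {i \<in> {1..n}. (i, j) \<in> Z})"
    by (intro card_mono) auto
  also have "\<dots> \<le> Suc (card {i \<in> {1..n}. (i, j) \<in> Z})" by (rule card_insert_le_m1) auto
  also have "\<dots> \<le> Suc s" using Z j by (simp add: line_bounded_def)
  finally show "card {i \<in> {1..n}. (i, j) \<in> ?Z} \<le> Suc s" .
qed

text \<open>The permutations that meet every member of \<open>G\<close> in \<open>t\<close> points although no set of at most \<open>m\<close> of
their points accounts for this.\<close>
definition uncovered :: "nat \<Rightarrow> nat \<Rightarrow> (nat \<Rightarrow> nat) set \<Rightarrow> nat \<Rightarrow> (nat \<Rightarrow> nat) set" where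
  "uncovered n t G m = {\<sigma> \<in> Sym n. t_cover t (perm_graph n ` G) (perm_graph n \<sigma>) \<and>
     (\<forall>C \<subseteq> perm_graph n \<sigma>. t_cover t (perm_graph n ` G) C \<longrightarrow> m < card C)}"

lemma agreement_outside:
  assumes "t \<le> card (perm_graph n \<sigma> \<inter> perm_graph n \<tau>)" and B: "B \<subseteq> perm_graph n \<sigma>"
    and c: "card (B \<inter> perm_graph n \<tau>) < t" and fin: "finite B"
  shows "\<exists>i\<in>{1..n} - fst ` B. \<sigma> i = \<tau> i"
proof -
  have "\<not> perm_graph n \<sigma> \<inter> perm_graph n \<tau> \<subseteq> B \<inter> perm_graph n \<tau>"
    using assms(1) c card_mono[of "B \<inter> perm_graph n \<tau>"] fin
    by (meson finite_Int leD le_trans)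
  then obtain x where x: "x \<in> perm_graph n \<sigma>" "x \<in> perm_graph n \<tau>" "x \<notin> B" by blast
  then obtain i where i: "i \<in> {1..n}" "\<sigma> i = \<tau> i" "(i, \<sigma> i) \<notin> B"
    unfolding perm_graph_def by fastforce
  have "i \<notin> fst ` B"
  proof
    assume "i \<in> fst ` B"
    then obtain b where "(i, b) \<in> B" by auto
    moreover from this have "b = \<sigma> i" using B by (auto simp: perm_graph_def)
    ultimately show False using i by simp
  qed
  thus ?thesis using i by blast
qed

text \<open>A decision tree, which reveals an unknown \<open>\<sigma>\<close> step by step: \<open>B\<close> collects the points known to
belong to \<open>\<sigma>\<close>, and \<open>Z\<close> those known not to. As \<open>B\<close> is small it is not a cover, so some
\<open>\<tau> \<in> G\<close> meets it in fewer than \<open>t\<close> points and \<open>\<sigma>\<close> must meet \<open>\<tau>\<close> outside \<open>B\<close>. Scan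
\<open>\<tau>\<close> row by row until the first agreement: the branches are disjoint, and together they contain at most
\<open>3 / 4\<close> of the permutations of the node, because the others miss \<open>\<tau>\<close> altogether. Each step adds one
point to \<open>B\<close> and at most one cell per line to \<open>Z\<close>. Keeping track of \<open>Z\<close> is essential: without
it the branches would overlap, and their total mass would not shrink.\<close>
lemma uncovered_branching:
  assumes G: "G \<subseteq> Sym n" and k: "t + 9 * k \<le> n + 5"
  shows "j + s = k \<Longrightarrow> card B = t + s \<Longrightarrow> finite B \<Longrightarrow> line_bounded n s Z \<Longrightarrow>
    card (uncovered n t G (t + k) \<inter> avoiding_coset n B Z)
      \<le> (3 / 4) ^ j * card (avoiding_coset n B Z)"
proof (induction j arbitrary: s B Z)
  case 0
  have "card (uncovered n t G (t + k) \<inter> avoiding_coset n B Z) \<le> card (avoiding_coset n B Z)"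
    by (rule card_mono[OF finite_avoiding]) auto
  thus ?case by simp
next
  case (Suc j)
  let ?U = "uncovered n t G (t + k)"
  let ?X = "avoiding_coset n B Z"
  let ?R = "{1..n} - fst ` B"
  show ?case
  proof (cases "?U \<inter> ?X = {}")
    case True
    show ?thesis unfolding True by simp
  next
    case False
    then obtain \<sigma>0 where \<sigma>0: "\<sigma>0 \<in> ?U" "\<sigma>0 \<in> ?X" by blast
    have "B \<subseteq> perm_graph n \<sigma>0" using \<sigma>0(2) by (simp add: avoiding_coset_def coset_def)
    moreover have "\<not> t + k < card B" using Suc.prems by simp
    ultimately have "\<not> t_cover t (perm_graph n ` G) B"
      using \<sigma>0(1) unfolding uncovered_def by blast
    then obtain \<tau> where \<tau>: "\<tau> \<in> G" "card (B \<inter> perm_graph n \<tau>) < t"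
      unfolding t_cover_def by (auto simp: not_le)
    have \<tau>S: "\<tau> \<in> Sym n" using \<tau> G by blast
    let ?H = "{\<sigma> \<in> ?X. \<exists>i\<in>?R. \<sigma> i = \<tau> i}"
    define Bi where "Bi i = insert (i, \<tau> i) B" for i
    define Zi where "Zi i = Z \<union> {(k, \<tau> k) |k. k \<in> {k \<in> ?R. k < i}}" for i
    define Xi where "Xi i = avoiding_coset n (Bi i) (Zi i)" for i
    have Xi_eq: "Xi i = {\<sigma> \<in> ?X. \<sigma> i = \<tau> i \<and> (\<forall>k\<in>?R. k < i \<longrightarrow> \<sigma> k \<noteq> \<tau> k)}"
      if "i \<in> ?R" for i
    proof -
      have "perm_graph n \<sigma> \<inter> Zi i = {} \<longleftrightarrow>
          perm_graph n \<sigma> \<inter> Z = {} \<and> (\<forall>k\<in>?R. k < i \<longrightarrow> \<sigma> k \<noteq> \<tau> k)" for \<sigma>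
        by (auto simp: Zi_def disjoint_iff mem_perm_graph)
      moreover have "Bi i \<subseteq> perm_graph n \<sigma> \<longleftrightarrow> B \<subseteq> perm_graph n \<sigma> \<and> \<sigma> i = \<tau> i" for \<sigma>
        using that by (auto simp: Bi_def mem_perm_graph)
      ultimately show ?thesis unfolding Xi_def avoiding_coset_def coset_def by blast
    qed
    have hit: "?U \<inter> ?X \<subseteq> ?H"
    proof
      fix \<sigma> assume s: "\<sigma> \<in> ?U \<inter> ?X"
      have "t \<le> card (perm_graph n \<sigma> \<inter> perm_graph n \<tau>)" "B \<subseteq> perm_graph n \<sigma>"
        using s \<tau>(1) by (auto simp: uncovered_def t_cover_def avoiding_coset_def coset_def)
      then obtain i where "i \<in> ?R" "\<sigma> i = \<tau> i"
        using agreement_outside[OF _ _ \<tau>(2) Suc.prems(3)] by blast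
      thus "\<sigma> \<in> ?H" using s by blast
    qed
    have H: "?H = (\<Union>i\<in>?R. Xi i)"
    proof (intro set_eqI iffI)
      fix \<sigma> assume h: "\<sigma> \<in> ?H"
      then obtain i where "i \<in> ?R \<and> \<sigma> i = \<tau> i" by blast
      hence "\<exists>i. (i \<in> ?R \<and> \<sigma> i = \<tau> i) \<and> (\<forall>k<i. \<not> (k \<in> ?R \<and> \<sigma> k = \<tau> k))"
        using exists_least_iff[of "\<lambda>i. i \<in> ?R \<and> \<sigma> i = \<tau> i"] by blast
      then obtain i where "i \<in> ?R" "\<sigma> i = \<tau> i" "\<forall>k\<in>?R. k < i \<longrightarrow> \<sigma> k \<noteq> \<tau> k" by blast
      hence "\<sigma> \<in> Xi i" using h Xi_eq by blast
      thus "\<sigma> \<in> (\<Union>i\<in>?R. Xi i)" using \<open>i \<in> ?R\<close> by blast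
    qed (use Xi_eq in blast)
    have disj: "Xi i \<inter> Xi i' = {}" if "i \<in> ?R" "i' \<in> ?R" "i \<noteq> i'" for i i'
      using that by (cases "i < i'") (fastforce simp: Xi_eq)+
    have cH: "card ?H = (\<Sum>i\<in>?R. card (Xi i))" unfolding H
      by (rule card_UN_disjoint) (use disj finite_avoiding in \<open>auto simp: Xi_def\<close>)
    have IH: "card (?U \<inter> Xi i) \<le> (3 / 4) ^ j * card (Xi i)" if "i \<in> ?R" for i
      unfolding Xi_def
    proof (rule Suc.IH)
      show "j + Suc s = k" using Suc.prems by simp
      have "(i, \<tau> i) \<notin> B" using that by force
      thus "card (Bi i) = t + Suc s" "finite (Bi i)" using Suc.prems by (simp_all add: Bi_def)
      show "line_bounded n (Suc s) (Zi i)" unfolding Zi_def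
        by (rule line_bounded_extend[OF Suc.prems(4) \<tau>S])
    qed
    have "card (?U \<inter> ?X) \<le> card (\<Union>i\<in>?R. ?U \<inter> Xi i)"
      by (rule card_mono) (use hit H finite_avoiding in \<open>auto simp: Xi_def\<close>)
    also have "\<dots> \<le> (\<Sum>i\<in>?R. card (?U \<inter> Xi i))" by (rule card_UN_le) simp
    finally have "real (card (?U \<inter> ?X)) \<le> (\<Sum>i\<in>?R. real (card (?U \<inter> Xi i)))"
      by (simp only: of_nat_sum[symmetric] of_nat_le_iff)
    also have "\<dots> \<le> (\<Sum>i\<in>?R. (3 / 4) ^ j * card (Xi i))" by (rule sum_mono) (rule IH)
    also have "\<dots> = (3 / 4) ^ j * card ?H" unfolding cH by (simp add: sum_distrib_left)
    also have "\<dots> \<le> (3 / 4) ^ j * (3 / 4 * card ?X)"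
      by (intro mult_left_mono card_hitting_le[OF Suc.prems(4) \<tau>S])
         (use Suc.prems k in auto)
    finally show ?thesis by simp
  qed
qed

definition spanned :: "nat \<Rightarrow> (nat \<times> nat) set set \<Rightarrow> (nat \<Rightarrow> nat) set" where
  "spanned n \<A> = (\<Union>A\<in>\<A>. coset n A)"

text \<open>The tree starts from the \<open>t\<close>-subsets of one member of \<open>G\<close>. They have total mass \<open>n! / t!\<close>
rather than \<open>n!\<close>, and this is why linearly many steps in \<open>t\<close> suffice when \<open>t\<close> is proportional to \<open>n\<close>.\<close>
lemma card_uncovered:
  assumes G: "G \<subseteq> Sym n" and k: "t + 9 * k \<le> n + 5"
  shows "card (uncovered n t G (t + k)) \<le> real ((n choose t) * fact (n - t)) * (3 / 4) ^ k"
proof (cases "G = {}")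
  case True
  hence "t_cover t (perm_graph n ` G) {}" by (simp add: t_cover_def)
  hence "uncovered n t G (t + k) = {}" unfolding uncovered_def by fastforce
  thus ?thesis by simp
next
  case False
  then obtain \<tau> where \<tau>: "\<tau> \<in> G" by blast
  let ?U = "uncovered n t G (t + k)"
  let ?\<S> = "{S. S \<subseteq> perm_graph n \<tau> \<and> card S = t}"
  have cg: "card (perm_graph n \<tau>) = n"
  proof -
    have "fst ` perm_graph n \<tau> = {1..n}" by (force simp: perm_graph_def)
    thus ?thesis using card_rows[of "perm_graph n \<tau>" n \<tau>] by simp
  qed
  have finS: "finite ?\<S>" using finite_perm_graph by simp
  have cS: "card ?\<S> = n choose t" using n_subsets[OF finite_perm_graph, of n \<tau> t] cg by simp
  have "?U \<subseteq> (\<Union>S\<in>?\<S>. ?U \<inter> avoiding_coset n S {})"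
  proof
    fix \<sigma> assume s: "\<sigma> \<in> ?U"
    hence "t \<le> card (perm_graph n \<sigma> \<inter> perm_graph n \<tau>)" and sS: "\<sigma> \<in> Sym n"
      using \<tau> by (auto simp: uncovered_def t_cover_def)
    then obtain S where S: "S \<subseteq> perm_graph n \<sigma> \<inter> perm_graph n \<tau>" "card S = t"
      by (meson obtain_subset_with_card_n)
    hence "\<sigma> \<in> avoiding_coset n S {}" using sS by (simp add: avoiding_coset_def coset_def)
    thus "\<sigma> \<in> (\<Union>S\<in>?\<S>. ?U \<inter> avoiding_coset n S {})" using s S by blast
  qed
  hence "card ?U \<le> card (\<Union>S\<in>?\<S>. ?U \<inter> avoiding_coset n S {})"
    by (rule card_mono[rotated]) (use finS finite_avoiding in auto)
  also have "\<dots> \<le> (\<Sum>S\<in>?\<S>. card (?U \<inter> avoiding_coset n S {}))" by (rule card_UN_le[OF finS])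
  finally have "real (card ?U) \<le> (\<Sum>S\<in>?\<S>. real (card (?U \<inter> avoiding_coset n S {})))"
    by (simp only: of_nat_sum[symmetric] of_nat_le_iff)
  also have "\<dots> \<le> (\<Sum>S\<in>?\<S>. (3 / 4) ^ k * fact (n - t))"
  proof (rule sum_mono)
    fix S assume S: "S \<in> ?\<S>"
    have "card (?U \<inter> avoiding_coset n S {}) \<le> (3 / 4) ^ k * card (avoiding_coset n S {})"
      by (rule uncovered_branching[OF G k, of k 0])
         (use S finite_subset[OF _ finite_perm_graph] in \<open>auto simp: line_bounded_def\<close>)
    also have "\<dots> \<le> (3 / 4) ^ k * fact (n - t)"
    proof (rule mult_left_mono)
      have "card (avoiding_coset n S {}) \<le> card (coset n S)"
        by (rule card_mono[OF finite_coset]) (auto simp: avoiding_coset_def)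
      also have "\<dots> \<le> fact (n - t)" using card_coset_le[of n S] S by simp
      finally have "real (card (avoiding_coset n S {})) \<le> real (fact (n - t))"
        by (simp only: of_nat_le_iff)
      thus "real (card (avoiding_coset n S {})) \<le> fact (n - t)" by (simp only: of_nat_fact)
    qed simp
    finally show "card (?U \<inter> avoiding_coset n S {}) \<le> (3 / 4) ^ k * fact (n - t)" .
  qed
  also have "\<dots> = real ((n choose t) * fact (n - t)) * (3 / 4) ^ k" by (simp add: cS)
  finally show ?thesis .
qed

lemma extend_avoiding:
  assumes A: "coset n A \<noteq> {}" and \<tau>: "\<tau> \<in> Sym n" and c: "card A + 5 \<le> n"
  obtains \<sigma> where "\<sigma> \<in> coset n A" "perm_graph n \<sigma> \<inter> perm_graph n \<tau> \<subseteq> A"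
proof -
  let ?H = "{\<sigma> \<in> avoiding_coset n A {}. \<exists>i\<in>{1..n} - fst ` A. \<sigma> i = \<tau> i}"
  have av: "avoiding_coset n A {} = coset n A" by (auto simp: avoiding_coset_def)
  have "card (coset n A) > 0" using A finite_coset by (simp add: card_gt_0_iff)
  moreover have "card ?H \<le> 3 / 4 * card (avoiding_coset n A {})"
    by (rule card_hitting_le[where s = 0]) (use \<tau> c in \<open>auto simp: line_bounded_def\<close>)
  ultimately have "card ?H < card (coset n A)" unfolding av by linarith
  hence "?H \<noteq> coset n A" by (metis less_irrefl)
  then obtain \<sigma> where s: "\<sigma> \<in> coset n A" "\<sigma> \<notin> ?H" unfolding av by blast
  have "perm_graph n \<sigma> \<inter> perm_graph n \<tau> \<subseteq> A"
  proof
    fix x assume x: "x \<in> perm_graph n \<sigma> \<inter> perm_graph n \<tau>"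
    then obtain i where i: "i \<in> {1..n}" "x = (i, \<sigma> i)" "\<sigma> i = \<tau> i" by (auto simp: perm_graph_def)
    hence "i \<in> fst ` A" using s unfolding av by auto
    then obtain b where "(i, b) \<in> A" by auto
    thus "x \<in> A" using s(1) i by (auto simp: coset_def perm_graph_def)
  qed
  thus thesis using that s by blast
qed

definition partial_perms :: "nat \<Rightarrow> (nat \<times> nat) set set" where
  "partial_perms n = {A. coset n A \<noteq> {}}"

lemma partial_perm_finite: "A \<in> partial_perms n \<Longrightarrow> finite A \<and> A \<subseteq> {1..n} \<times> {1..n}"
  unfolding partial_perms_def coset_def
  using finite_subset[OF _ finite_perm_graph] perm_graph_subset by blast

lemma approximate_by_covers:
  assumes F: "F \<subseteq> Sym n" and G: "G \<subseteq> Sym n" and cr: "cross_intersecting n t F G"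
    and k: "t + 9 * k \<le> n + 5"
    and \<A>: "\<A> = {A \<in> partial_perms n. card A \<le> t + k \<and> t_cover t (perm_graph n ` G) A}"
  shows "card (F - spanned n \<A>) \<le> real ((n choose t) * fact (n - t)) * (3 / 4) ^ k"
proof -
  have "F - spanned n \<A> \<subseteq> uncovered n t G (t + k)"
  proof
    fix \<sigma> assume s: "\<sigma> \<in> F - spanned n \<A>"
    have "t_cover t (perm_graph n ` G) (perm_graph n \<sigma>)"
      using cr s by (auto simp: t_cover_def cross_intersecting_def card_perm_graph_Int)
    moreover have "t + k < card C"
      if C: "C \<subseteq> perm_graph n \<sigma>" "t_cover t (perm_graph n ` G) C" for C
    proof (rule ccontr)
      assume "\<not> t + k < card C"
      moreover have "\<sigma> \<in> coset n C" using s F C by (auto simp: coset_def)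
      ultimately have "C \<in> \<A>" using C unfolding \<A> partial_perms_def by auto
      thus False using s \<open>\<sigma> \<in> coset n C\<close> by (auto simp: spanned_def)
    qed
    ultimately show "\<sigma> \<in> uncovered n t G (t + k)" using s F by (auto simp: uncovered_def)
  qed
  hence "card (F - spanned n \<A>) \<le> card (uncovered n t G (t + k))"
    by (rule card_mono[rotated]) (simp add: uncovered_def finite_Sym)
  thus ?thesis using card_uncovered[OF G k] by linarith
qed

definition cross_sets :: "nat \<Rightarrow> 'a set set \<Rightarrow> 'a set set \<Rightarrow> bool" where
  "cross_sets t \<A> \<B> \<longleftrightarrow> (\<forall>A\<in>\<A>. \<forall>B\<in>\<B>. t \<le> card (A \<inter> B))"

lemma spanned_Sym: "spanned n \<A> \<subseteq> Sym n"
  by (auto simp: spanned_def coset_def)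

text \<open>The members of \<open>\<A>\<close> are covers of \<open>G\<close>, those of \<open>\<B>\<close> are covers of the family that
\<open>\<A>\<close> spans. As a small partial permutation can be completed without creating new agreements with a given
permutation, the two systems of covers meet each other in \<open>t\<close> cells.\<close>
lemma approximate_both:
  assumes F: "F \<subseteq> Sym n" and G: "G \<subseteq> Sym n" and cr: "cross_intersecting n t F G"
    and k: "t + 9 * k \<le> n + 5" "t + k + 5 \<le> n"
  obtains \<A> \<B> where "\<A> \<subseteq> partial_perms n" "\<B> \<subseteq> partial_perms n" "cross_sets t \<A> \<B>"
    "\<And>A. A \<in> \<A> \<Longrightarrow> card A \<le> t + k" "\<And>B. B \<in> \<B> \<Longrightarrow> card B \<le> t + k"
    "card (F - spanned n \<A>) \<le> real ((n choose t) * fact (n - t)) * (3 / 4) ^ k"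
    "card (G - spanned n \<B>) \<le> real ((n choose t) * fact (n - t)) * (3 / 4) ^ k"
proof -
  define \<A> where "\<A> = {A \<in> partial_perms n. card A \<le> t + k \<and> t_cover t (perm_graph n ` G) A}"
  define F' where "F' = spanned n \<A>"
  define \<B> where "\<B> = {B \<in> partial_perms n. card B \<le> t + k \<and> t_cover t (perm_graph n ` F') B}"
  have F': "F' \<subseteq> Sym n" unfolding F'_def by (rule spanned_Sym)
  have crG: "cross_intersecting n t G F'"
    unfolding cross_intersecting_def
  proof (intro ballI)
    fix \<tau> \<sigma> assume \<tau>: "\<tau> \<in> G" and "\<sigma> \<in> F'"
    then obtain A where A: "A \<in> \<A>" "A \<subseteq> perm_graph n \<sigma>"
      by (auto simp: F'_def spanned_def coset_def)
    have "t \<le> card (A \<inter> perm_graph n \<tau>)" using A \<tau> by (auto simp: \<A>_def t_cover_def)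
    also have "\<dots> \<le> card (perm_graph n \<tau> \<inter> perm_graph n \<sigma>)"
      by (rule card_mono) (use A finite_perm_graph in auto)
    finally show "t \<le> card {i \<in> {1..n}. \<tau> i = \<sigma> i}" by (simp add: card_perm_graph_Int)
  qed
  have "cross_sets t \<A> \<B>" unfolding cross_sets_def
  proof (intro ballI)
    fix A B assume A: "A \<in> \<A>" and B: "B \<in> \<B>"
    from B obtain \<tau> where \<tau>: "\<tau> \<in> Sym n" "B \<subseteq> perm_graph n \<tau>"
      by (auto simp: \<B>_def partial_perms_def coset_def)
    have "coset n A \<noteq> {}" "card A + 5 \<le> n" using A k by (auto simp: \<A>_def partial_perms_def)
    then obtain \<sigma> where s: "\<sigma> \<in> coset n A" "perm_graph n \<sigma> \<inter> perm_graph n \<tau> \<subseteq> A"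
      using extend_avoiding[OF _ \<tau>(1)] by metis
    have "\<sigma> \<in> F'" using s A by (auto simp: F'_def spanned_def)
    hence "t \<le> card (B \<inter> perm_graph n \<sigma>)" using B by (auto simp: \<B>_def t_cover_def)
    also have "\<dots> \<le> card (A \<inter> B)"
      by (rule card_mono)
         (use s \<tau> A partial_perm_finite in \<open>auto simp: \<A>_def\<close>)
    finally show "t \<le> card (A \<inter> B)" .
  qed
  thus thesis
    by (intro that[of \<A> \<B>])
       (use approximate_by_covers[OF F G cr k(1) \<A>_def] approximate_by_covers[OF G F' crG k(1) \<B>_def]
        in \<open>auto simp: \<A>_def \<B>_def\<close>)
qed

section \<open>Peeling off large covers\<close>
definition min_cover :: "nat \<Rightarrow> 'a set set \<Rightarrow> 'a set \<Rightarrow> bool" where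
  "min_cover t \<B> A \<longleftrightarrow> t_cover t \<B> A \<and> (\<forall>A'. A' \<subset> A \<longrightarrow> \<not> t_cover t \<B> A')"

lemma obtain_min_cover:
  assumes "finite A" "t_cover t \<B> A"
  obtains A' where "A' \<subseteq> A" "min_cover t \<B> A'"
proof -
  have "\<exists>A'\<subseteq>A. min_cover t \<B> A'"
    using assms
  proof (induction A rule: finite_psubset_induct)
    case (psubset A)
    show ?case
    proof (cases "min_cover t \<B> A")
      case False
      hence "\<exists>A'. A' \<subset> A \<and> t_cover t \<B> A'"
        using psubset.prems by (simp add: min_cover_def)
      then obtain A' where A': "A' \<subset> A" "t_cover t \<B> A'" by (elim exE conjE)
      from psubset.IH[OF this] obtain A'' where "A'' \<subseteq> A'" "min_cover t \<B> A''" by (elim exE conjE)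
      moreover from this A' have "A'' \<subseteq> A" by (meson psubset_imp_subset subset_trans)
      ultimately show ?thesis by (intro exI conjI)
    next
      case True
      thus ?thesis by (intro exI[of _ A]) simp
    qed
  qed
  thus thesis using that by blast
qed

lemma choose_add_le_power: "(c + r) choose r \<le> (c + 1) ^ r"
proof (induction r)
  case (Suc r)
  have "Suc r * ((c + Suc r) choose Suc r) = (c + Suc r) * ((c + r) choose r)"
    using Suc_times_binomial[of r "c + r"] by simp
  also have "\<dots> \<le> (Suc r * (c + 1)) * (c + 1) ^ r"
    by (rule mult_le_mono[OF _ Suc.IH]) (simp add: algebra_simps)
  also have "\<dots> = Suc r * (c + 1) ^ Suc r" by (simp only: power_Suc mult.assoc)
  finally show ?case by (simp only: mult_le_cancel1)
qed simp

text \<open>While \<open>A'\<close> is not a cover, some \<open>B \<in> \<B>\<close> meets it in only \<open>t - r\<close> points, and every cover above \<open>A'\<close>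
contains \<open>r\<close> further points of \<open>B\<close>. Only \<open>c + r\<close> points of \<open>B\<close> are available for them, so there are at
most \<open>(c + 1) ^ r\<close> choices. A factor \<open>c + 1\<close> per point, instead of the size \<open>t + c\<close> of \<open>B\<close>, is what
makes the method work for \<open>n\<close> linear in \<open>t\<close>.\<close>
lemma card_min_covers_above:
  assumes U: "finite U" and \<B>: "\<And>B. B \<in> \<B> \<Longrightarrow> finite B \<and> card B \<le> t + c"
  shows "finite A' \<Longrightarrow>
    card {A. A \<subseteq> U \<and> A' \<subseteq> A \<and> card A = card A' + m \<and> min_cover t \<B> A} \<le> (c + 1) ^ m"
proof (induction m arbitrary: A' rule: less_induct)
  case (less m)
  define M where "M A' m = {A. A \<subseteq> U \<and> A' \<subseteq> A \<and> card A = card A' + m \<and> min_cover t \<B> A}" for A' m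
  have finM: "finite (M A' m)" for A' m
    by (rule finite_subset[of _ "Pow U"]) (use U in \<open>auto simp: M_def\<close>)
  have "card (M A' m) \<le> (c + 1) ^ m"
  proof (cases "t_cover t \<B> A'")
    case True
    have "M A' m \<subseteq> {A'}" using True unfolding M_def min_cover_def by blast
    hence "card (M A' m) \<le> card {A'}" by (rule card_mono[rotated]) simp
    also have "\<dots> \<le> (c + 1) ^ m" by simp
    finally show ?thesis .
  next
    case False
    then obtain B where B: "B \<in> \<B>" "card (A' \<inter> B) < t" by (auto simp: t_cover_def not_le)
    define r where "r = t - card (A' \<inter> B)"
    have r: "r \<ge> 1" "card (A' \<inter> B) + r = t" using B by (auto simp: r_def)
    have fB: "finite B" and cB: "card B \<le> t + c" using \<B> B by auto
    let ?\<R> = "{R. R \<subseteq> B - A' \<and> card R = r}"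
    have finR: "finite ?\<R>" using fB by simp
    have "card (B - A') + card (A' \<inter> B) = card B"
      using card_Diff_subset_Int[of B A'] fB card_mono[of B "A' \<inter> B"]
      by (simp add: Int_commute)
    hence "card (B - A') \<le> c + r" using cB r by linarith
    hence "card ?\<R> \<le> (c + r) choose r"
      using n_subsets[of "B - A'" r] fB binomial_right_mono by simp
    hence cR: "card ?\<R> \<le> (c + 1) ^ r" using choose_add_le_power le_trans by blast
    have pick: "\<exists>R\<in>?\<R>. R \<subseteq> A - A'" if A: "A \<in> M A' m" for A
    proof -
      have "finite A" using A U finite_subset unfolding M_def by blast
      have "t \<le> card (A \<inter> B)" using A B by (auto simp: M_def min_cover_def t_cover_def)
      also have "A \<inter> B = (A' \<inter> B) \<union> ((A - A') \<inter> B)" using A by (auto simp: M_def)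
      also have "card \<dots> \<le> card (A' \<inter> B) + card ((A - A') \<inter> B)" by (rule card_Un_le)
      finally have "r \<le> card ((A - A') \<inter> B)" using r by linarith
      then obtain R where "R \<subseteq> (A - A') \<inter> B" "card R = r" by (meson obtain_subset_with_card_n)
      thus ?thesis by blast
    qed
    show ?thesis
    proof (cases "r \<le> m")
      case False
      have "M A' m = {}"
      proof (rule ccontr)
        assume "M A' m \<noteq> {}"
        then obtain A R where A: "A \<in> M A' m" and R: "R \<subseteq> A - A'" "card R = r"
          using pick by blast
        have "finite A" using A U finite_subset unfolding M_def by blast
        hence "r \<le> card (A - A')" using R card_mono by blast
        also have "\<dots> = m" using A less.prems by (simp add: M_def card_Diff_subset)
        finally show False using False by simp
      qed
      thus ?thesis by simp
    next
      case True
      have "M A' m \<subseteq> (\<Union>R\<in>?\<R>. M (A' \<union> R) (m - r))"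
      proof
        fix A assume A: "A \<in> M A' m"
        then obtain R where R: "R \<in> ?\<R>" "R \<subseteq> A - A'" using pick by blast
        have "card (A' \<union> R) = card A' + r"
          using R fB less.prems finite_subset[of R "B - A'"]
          by (subst card_Un_disjoint) auto
        hence "A \<in> M (A' \<union> R) (m - r)" using A R True by (auto simp: M_def)
        thus "A \<in> (\<Union>R\<in>?\<R>. M (A' \<union> R) (m - r))" using R by blast
      qed
      hence "card (M A' m) \<le> card (\<Union>R\<in>?\<R>. M (A' \<union> R) (m - r))"
        by (rule card_mono[rotated]) (use finR finM in auto)
      also have "\<dots> \<le> (\<Sum>R\<in>?\<R>. card (M (A' \<union> R) (m - r)))" by (rule card_UN_le[OF finR])
      also have "\<dots> \<le> (\<Sum>R\<in>?\<R>. (c + 1) ^ (m - r))"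
      proof (rule sum_mono)
        fix R assume "R \<in> ?\<R>"
        hence "finite (A' \<union> R)" using less.prems fB finite_subset[of R "B - A'"] by auto
        thus "card (M (A' \<union> R) (m - r)) \<le> (c + 1) ^ (m - r)"
          unfolding M_def using less.IH[of "m - r" "A' \<union> R"] r True by simp
      qed
      also have "\<dots> = card ?\<R> * (c + 1) ^ (m - r)" by simp
      also have "\<dots> \<le> (c + 1) ^ r * (c + 1) ^ (m - r)" by (rule mult_right_mono[OF cR]) simp
      also have "\<dots> = (c + 1) ^ m" using True by (simp add: power_add[symmetric])
      finally show ?thesis .
    qed
  qed
  thus ?case by (simp add: M_def)
qed

lemma card_min_covers:
  assumes U: "finite U" and \<B>: "\<And>B. B \<in> \<B> \<Longrightarrow> finite B \<and> card B \<le> t + c" and ne: "\<B> \<noteq> {}"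
  shows "card {A. A \<subseteq> U \<and> card A = t + m \<and> min_cover t \<B> A} \<le> ((t + c) choose t) * (c + 1) ^ m"
proof -
  obtain B where B: "B \<in> \<B>" using ne by blast
  have fB: "finite B" and cB: "card B \<le> t + c" using \<B> B by auto
  let ?\<S> = "{S. S \<subseteq> B \<and> card S = t}"
  have finS: "finite ?\<S>" using fB by simp
  have cS: "card ?\<S> \<le> (t + c) choose t"
    using n_subsets[OF fB, of t] cB binomial_right_mono by simp
  define M where "M S = {A. A \<subseteq> U \<and> S \<subseteq> A \<and> card A = card S + m \<and> min_cover t \<B> A}" for S
  have finM: "finite (M S)" for S
    by (rule finite_subset[of _ "Pow U"]) (use U in \<open>auto simp: M_def\<close>)
  have "{A. A \<subseteq> U \<and> card A = t + m \<and> min_cover t \<B> A} \<subseteq> (\<Union>S\<in>?\<S>. M S)"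
  proof
    fix A assume A: "A \<in> {A. A \<subseteq> U \<and> card A = t + m \<and> min_cover t \<B> A}"
    hence "t \<le> card (A \<inter> B)" using B by (auto simp: min_cover_def t_cover_def)
    then obtain S where "S \<subseteq> A \<inter> B" "card S = t" by (meson obtain_subset_with_card_n)
    thus "A \<in> (\<Union>S\<in>?\<S>. M S)" using A by (auto simp: M_def)
  qed
  hence "card {A. A \<subseteq> U \<and> card A = t + m \<and> min_cover t \<B> A} \<le> card (\<Union>S\<in>?\<S>. M S)"
    by (rule card_mono[rotated]) (use finS finM in auto)
  also have "\<dots> \<le> (\<Sum>S\<in>?\<S>. card (M S))" by (rule card_UN_le[OF finS])
  also have "\<dots> \<le> (\<Sum>S\<in>?\<S>. (c + 1) ^ m)"
    unfolding M_def
    by (rule sum_mono, rule card_min_covers_above[OF U \<B>]) (use fB finite_subset in auto)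
  also have "\<dots> = card ?\<S> * (c + 1) ^ m" by simp
  also have "\<dots> \<le> ((t + c) choose t) * (c + 1) ^ m" by (rule mult_right_mono[OF cS]) simp
  finally show ?thesis .
qed

definition peel_cost :: "nat \<Rightarrow> nat \<Rightarrow> nat \<Rightarrow> nat" where
  "peel_cost n t c = ((t + c) choose t) * (c + 1) ^ c * fact (n - t - c)"

lemma partial_perms_subset: "A \<in> partial_perms n \<Longrightarrow> A' \<subseteq> A \<Longrightarrow> A' \<in> partial_perms n"
  unfolding partial_perms_def coset_def by blast

text \<open>Replacing the members of \<open>\<A>\<close> by minimal covers of \<open>\<B>\<close> loses nothing. Minimal covers of the maximal
size \<open>t + c\<close> are few, and each of them spans a small coset, so they may be dropped.\<close>
lemma peel_one_side:
  assumes F: "F \<subseteq> Sym n" and \<A>: "\<A> \<subseteq> partial_perms n" "\<And>A. A \<in> \<A> \<Longrightarrow> card A \<le> t + c"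
    and \<B>: "\<B> \<subseteq> partial_perms n" "\<And>B. B \<in> \<B> \<Longrightarrow> card B \<le> t + c" "\<B> \<noteq> {}"
    and cr: "cross_sets t \<A> \<B>"
  obtains \<A>' where "\<A>' \<subseteq> partial_perms n" "cross_sets t \<A>' \<B>"
    "\<And>A. A \<in> \<A>' \<Longrightarrow> card A < t + c"
    "card (F - spanned n \<A>') \<le> card (F - spanned n \<A>) + peel_cost n t c"
proof -
  define \<A>' where "\<A>' = {A \<in> partial_perms n. min_cover t \<B> A \<and> card A < t + c}"
  let ?U = "{1..n} \<times> {1..n}"
  let ?M = "{A. A \<subseteq> ?U \<and> card A = t + c \<and> min_cover t \<B> A}"
  have finF: "finite F" using F finite_Sym finite_subset by blast
  have finM: "finite ?M" by (rule finite_subset[of _ "Pow ?U"]) auto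
  have sub: "F - spanned n \<A>' \<subseteq> (F - spanned n \<A>) \<union> (\<Union>A\<in>?M. coset n A)"
  proof
    fix \<sigma> assume s: "\<sigma> \<in> F - spanned n \<A>'"
    show "\<sigma> \<in> (F - spanned n \<A>) \<union> (\<Union>A\<in>?M. coset n A)"
    proof (cases "\<sigma> \<in> spanned n \<A>")
      case True
      then obtain A where A: "A \<in> \<A>" "\<sigma> \<in> coset n A" by (auto simp: spanned_def)
      have fA: "finite A" using A \<A> partial_perm_finite by blast
      have "t_cover t \<B> A" using cr A by (auto simp: cross_sets_def t_cover_def)
      then obtain A' where A': "A' \<subseteq> A" "min_cover t \<B> A'" using obtain_min_cover[OF fA] by blast
      have c: "card A' \<le> t + c" using A' A \<A>(2) card_mono[OF fA] le_trans by blast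
      have s': "\<sigma> \<in> coset n A'" using A A' by (auto simp: coset_def)
      have p: "A' \<in> partial_perms n" using A A' \<A>(1) partial_perms_subset by blast
      have "\<not> card A' < t + c" using s s' p A' by (auto simp: \<A>'_def spanned_def)
      hence "A' \<in> ?M" using c A' partial_perm_finite[OF p] by auto
      thus ?thesis using s' by blast
    qed (use s in blast)
  qed
  have "card (\<Union>A\<in>?M. coset n A) \<le> (\<Sum>A\<in>?M. card (coset n A))" by (rule card_UN_le[OF finM])
  also have "\<dots> \<le> (\<Sum>A\<in>?M. fact (n - t - c))"
  proof (rule sum_mono)
    fix A assume "A \<in> ?M"
    thus "card (coset n A) \<le> fact (n - t - c)" using card_coset_le[of n A] by simp
  qed
  also have "\<dots> = card ?M * fact (n - t - c)" by simp
  also have "\<dots> \<le> peel_cost n t c" unfolding peel_cost_def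
    by (intro mult_right_mono card_min_covers) (use \<B> partial_perm_finite in auto)
  finally have u: "card (\<Union>A\<in>?M. coset n A) \<le> peel_cost n t c" .
  have "card (F - spanned n \<A>') \<le> card ((F - spanned n \<A>) \<union> (\<Union>A\<in>?M. coset n A))"
    by (rule card_mono[OF _ sub]) (use finF finM finite_coset in auto)
  also have "\<dots> \<le> card (F - spanned n \<A>) + card (\<Union>A\<in>?M. coset n A)" by (rule card_Un_le)
  finally have "card (F - spanned n \<A>') \<le> card (F - spanned n \<A>) + peel_cost n t c" using u by linarith
  moreover have "cross_sets t \<A>' \<B>" by (auto simp: \<A>'_def min_cover_def t_cover_def cross_sets_def)
  ultimately show thesis by (intro that[of \<A>']) (auto simp: \<A>'_def)
qed

lemma cross_sets_sym: "cross_sets t \<A> \<B> \<longleftrightarrow> cross_sets t \<B> \<A>"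
  unfolding cross_sets_def by (metis Int_commute)

text \<open>Both systems are peeled alternately, from size \<open>t + k\<close> down to size \<open>t + 1\<close>. Minimal covers are counted
starting from a member of the opposite system; the lower bounds on the sizes of the families ensure that
neither system ever becomes empty.\<close>
lemma peel:
  fixes e :: real
  assumes F: "F \<subseteq> Sym n" and G: "G \<subseteq> Sym n"
    and \<A>0: "\<A>0 \<subseteq> partial_perms n" "\<And>A. A \<in> \<A>0 \<Longrightarrow> card A \<le> t + k"
    and \<B>0: "\<B>0 \<subseteq> partial_perms n" "\<And>B. B \<in> \<B>0 \<Longrightarrow> card B \<le> t + k"
    and cr: "cross_sets t \<A>0 \<B>0"
    and eF: "card (F - spanned n \<A>0) \<le> e" and eG: "card (G - spanned n \<B>0) \<le> e"
    and big: "card F > e + (\<Sum>j\<in>{2..k}. peel_cost n t j)"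
      "card G > e + (\<Sum>j\<in>{2..k}. peel_cost n t j)"
    and k: "k \<ge> 1"
  obtains \<A> \<B> where "\<A> \<subseteq> partial_perms n" "\<B> \<subseteq> partial_perms n" "cross_sets t \<A> \<B>"
    "\<And>A. A \<in> \<A> \<Longrightarrow> card A \<le> t + 1" "\<And>B. B \<in> \<B> \<Longrightarrow> card B \<le> t + 1"
    "card (F - spanned n \<A>) \<le> e + (\<Sum>j\<in>{2..k}. peel_cost n t j)"
    "card (G - spanned n \<B>) \<le> e + (\<Sum>j\<in>{2..k}. peel_cost n t j)"
proof -
  let ?P = "\<lambda>c. \<exists>\<A> \<B>. \<A> \<subseteq> partial_perms n \<and> \<B> \<subseteq> partial_perms n \<and> cross_sets t \<A> \<B> \<and>
    (\<forall>A\<in>\<A>. card A \<le> t + c) \<and> (\<forall>B\<in>\<B>. card B \<le> t + c) \<and>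
    card (F - spanned n \<A>) \<le> e + (\<Sum>j\<in>{Suc c..k}. peel_cost n t j) \<and>
    card (G - spanned n \<B>) \<le> e + (\<Sum>j\<in>{Suc c..k}. peel_cost n t j)"
  have "?P 1"
  proof (rule inc_induct[OF k, of ?P])
    show "?P k" using assms by (intro exI[of _ \<A>0] exI[of _ \<B>0]) simp
  next
    fix c assume c: "1 \<le> c" "c < k" and P: "?P (Suc c)"
    let ?s = "\<Sum>j\<in>{Suc (Suc c)..k}. peel_cost n t j"
    let ?s' = "\<Sum>j\<in>{Suc c..k}. peel_cost n t j"
    have s': "?s' = peel_cost n t (Suc c) + ?s"
      using c by (simp add: sum.atLeast_Suc_atMost)
    have le: "?s' \<le> (\<Sum>j\<in>{2..k}. peel_cost n t j)"
      by (rule sum_mono2) (use c in auto)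
    obtain \<A> \<B> where *: "\<A> \<subseteq> partial_perms n" "\<B> \<subseteq> partial_perms n" "cross_sets t \<A> \<B>"
      "\<And>A. A \<in> \<A> \<Longrightarrow> card A \<le> t + Suc c" "\<And>B. B \<in> \<B> \<Longrightarrow> card B \<le> t + Suc c"
      "card (F - spanned n \<A>) \<le> e + ?s" "card (G - spanned n \<B>) \<le> e + ?s"
      using P by blast
    have "\<B> \<noteq> {}"
    proof
      assume "\<B> = {}"
      hence "real (card G) \<le> e + ?s" using *(7) by (simp add: spanned_def)
      thus False using big(2) le s' by linarith
    qed
    then obtain \<A>' where A': "\<A>' \<subseteq> partial_perms n" "cross_sets t \<A>' \<B>"
      "\<And>A. A \<in> \<A>' \<Longrightarrow> card A < t + Suc c"
      "card (F - spanned n \<A>') \<le> card (F - spanned n \<A>) + peel_cost n t (Suc c)"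
      using peel_one_side[OF F *(1,4) *(2,5) _ *(3)] by metis
    have FA': "real (card (F - spanned n \<A>')) \<le> e + ?s'" using A'(4) *(6) s' by linarith
    have ne: "\<A>' \<noteq> {}"
    proof
      assume "\<A>' = {}"
      hence "real (card F) \<le> e + ?s'" using FA' by (simp add: spanned_def)
      thus False using big(1) le by linarith
    qed
    have A'c: "card A \<le> t + Suc c" if "A \<in> \<A>'" for A using A'(3)[OF that] by simp
    obtain \<B>' where B': "\<B>' \<subseteq> partial_perms n" "cross_sets t \<B>' \<A>'"
      "\<And>B. B \<in> \<B>' \<Longrightarrow> card B < t + Suc c"
      "card (G - spanned n \<B>') \<le> card (G - spanned n \<B>) + peel_cost n t (Suc c)"
      using peel_one_side[OF G *(2,5) A'(1) A'c ne] A'(2) cross_sets_sym by metis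
    have GB': "real (card (G - spanned n \<B>')) \<le> e + ?s'" using B'(4) *(7) s' by linarith
    have "cross_sets t \<A>' \<B>'" using B'(2) by (subst cross_sets_sym)
    moreover have "\<forall>A\<in>\<A>'. card A \<le> t + c" "\<forall>B\<in>\<B>'. card B \<le> t + c" using A'(3) B'(3) by (simp_all add: less_Suc_eq_le)
    ultimately show "?P c" using A'(1) B'(1) FA' GB' by blast
  qed
  then obtain \<A> \<B> where "\<A> \<subseteq> partial_perms n" "\<B> \<subseteq> partial_perms n" "cross_sets t \<A> \<B>"
    "\<And>A. A \<in> \<A> \<Longrightarrow> card A \<le> t + 1" "\<And>B. B \<in> \<B> \<Longrightarrow> card B \<le> t + 1"
    "card (F - spanned n \<A>) \<le> e + (\<Sum>j\<in>{Suc 1..k}. peel_cost n t j)"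
    "card (G - spanned n \<B>) \<le> e + (\<Sum>j\<in>{Suc 1..k}. peel_cost n t j)" by blast
  thus thesis using that by (simp add: numeral_2_eq_2)
qed

section \<open>Estimates\<close>
lemma succ_power_le:
  assumes "j \<le> m" "m \<ge> 1"
  shows "real (m + 1) ^ j \<le> 3 * real m ^ j"
proof -
  have m: "real m > 0" using assms by simp
  have "(1 + 1 / real m) ^ j \<le> exp (1 / real m) ^ j"
    by (rule power_mono) (use exp_ge_add_one_self in auto)
  also have "\<dots> = exp (real j / real m)" by (simp add: exp_of_nat_mult[symmetric])
  also have "\<dots> \<le> exp 1" using assms m by simp
  also have "\<dots> \<le> (3 :: real)" by (rule exp_le)
  finally have "(1 + 1 / real m) ^ j * real m ^ j \<le> 3 * real m ^ j"
    by (rule mult_right_mono) simp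
  moreover have "(1 + 1 / real m) * real m = real (m + 1)" using m by (simp add: field_simps)
  ultimately show ?thesis by (metis power_mult_distrib)
qed

lemma power_self_le_fact: "real t ^ t \<le> 3 ^ t * fact t"
proof (induction t)
  case (Suc t)
  have "real (Suc t) ^ Suc t \<le> real (Suc t) * (3 * real t ^ t)"
  proof (cases "t = 0")
    case False
    have "real (Suc t) ^ t \<le> 3 * real t ^ t" using succ_power_le[of t t] False by simp
    thus ?thesis by (simp only: power_Suc mult_left_mono of_nat_0_le_iff)
  qed simp
  also have "\<dots> \<le> real (Suc t) * (3 * (3 ^ t * fact t))"
    by (intro mult_left_mono Suc.IH) auto
  also have "\<dots> = 3 ^ Suc t * fact (Suc t)" by (simp add: algebra_simps)
  finally show ?case .
qed simp

lemma choose_le_ratio_power: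
  assumes "t \<ge> 1"
  shows "real (n choose t) \<le> (3 * real n / real t) ^ t"
proof -
  have "real ((n choose t) * fact t) \<le> real (n ^ t)"
    using binomial_fact_pow[of n t] by (simp only: of_nat_le_iff)
  hence "real (n choose t) * fact t \<le> real n ^ t" by simp
  hence "real (n choose t) \<le> real n ^ t / fact t" by (simp add: field_simps)
  also have "\<dots> \<le> real n ^ t * (3 ^ t / real t ^ t)"
  proof -
    have "1 / fact t \<le> 3 ^ t / real t ^ t"
      using power_self_le_fact[of t] assms by (simp add: field_simps)
    hence "real n ^ t * (1 / fact t) \<le> real n ^ t * (3 ^ t / real t ^ t)"
      by (rule mult_left_mono) simp
    thus ?thesis by simp
  qed
  also have "\<dots> = (3 * real n / real t) ^ t" by (simp add: power_divide power_mult_distrib)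
  finally show ?thesis .
qed

text \<open>With \<open>r = n / t\<close> and the bound \<open>(3 * r) ^ t\<close> for the binomial coefficient, this is the case \<open>t = 2\<close> of the comparison of \<open>(n choose t) * n\<close> with
\<open>(4 / 3) ^ (n / 10)\<close>; at \<open>r = 400\<close> the two sides are already of the same order of magnitude.\<close>
lemma exponential_beats_cubic:
  fixes r :: real
  assumes "r \<ge> 400"
  shows "120 * r ^ 3 \<le> (4 / 3) powr (r / 5)"
proof -
  define x where "x = r - 400"
  have x: "x \<ge> 0" "r = 400 * (1 + x / 400)" using assms by (simp_all add: x_def field_simps)
  have ln: "1 / 4 \<le> ln (4 / 3 :: real)"
    using ln_ge_iff[of "4/3::real" "1/4"] exp_bound[of "1/4::real"] by (simp add: power2_eq_square)
  have "r ^ 3 = 400 ^ 3 * (1 + x / 400) ^ 3" using x by (simp only: power_mult_distrib)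
  also have "\<dots> \<le> 400 ^ 3 * exp (x / 400) ^ 3"
    by (intro mult_left_mono power_mono) (use x exp_ge_add_one_self in auto)
  also have "exp (x / 400) ^ 3 = exp (3 * x / 400)" by (simp add: exp_of_nat_mult[symmetric])
  also have "400 ^ 3 * exp (3 * x / 400) \<le> 400 ^ 3 * exp (x / 5 * ln (4 / 3))"
  proof -
    have "3 * x / 400 \<le> x / 5 * (1 / 4)" using x by simp
    also have "\<dots> \<le> x / 5 * ln (4 / 3)" by (rule mult_left_mono[OF ln]) (use x in simp)
    finally show ?thesis by simp
  qed
  also have "exp (x / 5 * ln (4 / 3)) = (4 / 3) powr (x / 5)" by (simp add: powr_def)
  finally have "120 * r ^ 3 \<le> (120 * 400 ^ 3) * (4 / 3) powr (x / 5)" by simp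
  also have "\<dots> \<le> (4 / 3) powr 80 * (4 / 3) powr (x / 5)"
  proof (rule mult_right_mono)
    have "(4 / 3 :: real) powr 80 = (4 / 3) ^ 80" using powr_realpow[of "4/3::real" 80] by simp
    also have "\<dots> \<ge> 120 * 400 ^ 3" by (simp add: power_divide)
    finally show "120 * 400 ^ 3 \<le> (4 / 3 :: real) powr 80" .
  qed simp
  also have "\<dots> = (4 / 3) powr (80 + x / 5)" by (rule powr_add[symmetric])
  also have "80 + x / 5 = r / 5" by (simp add: x_def field_simps)
  finally show ?thesis .
qed

lemma choose_times_le_exponential:
  fixes n t :: nat
  assumes t: "t \<ge> 2" and n: "n \<ge> 400 * t"
  shows "10 * real (n choose t) * real n \<le> real t * (4 / 3) ^ (n div 10)"
proof -
  define r where "r = real n / real t"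
  define y where "y = (4 / 3 :: real) powr (r / 10)"
  have r: "r \<ge> 400" "real n = r * t"
    using n t of_nat_le_iff[of "400 * t" n, where 'a = real] by (auto simp: r_def field_simps)
  have y2: "120 * r ^ 3 \<le> y ^ 2"
    using exponential_beats_cubic[OF r(1)]
    by (simp add: y_def power2_eq_square powr_add[symmetric])
  have ypos: "y > 0" by (simp add: y_def)
  have r0: "r > 0" using r by simp
  have q2: "40 / 3 * r \<le> (y / (3 * r)) ^ 2"
    using y2 r0 by (simp add: power_divide field_simps power2_eq_square power3_eq_cube)
  have q1: "1 \<le> y / (3 * r)"
  proof (rule ccontr)
    assume "\<not> 1 \<le> y / (3 * r)"
    hence "(y / (3 * r)) ^ 2 \<le> 1" using ypos r0 by (intro power_le_one) auto
    thus False using q2 r by linarith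
  qed
  have "40 / 3 * r \<le> (y / (3 * r)) ^ t"
    using q2 power_increasing[OF t q1] by linarith
  hence "40 / 3 * r * (3 * r) ^ t \<le> y ^ t" using r0 by (simp add: power_divide field_simps)
  hence yt: "10 * r * (3 * r) ^ t \<le> 3 / 4 * y ^ t" by simp
  have "3 / 4 * y ^ t \<le> (4 / 3) ^ (n div 10)"
  proof -
    have "y ^ t = (4 / 3) powr (real n / 10)"
      unfolding y_def using r(2) by (simp add: powr_realpow[symmetric] powr_powr)
    also have "\<dots> \<le> (4 / 3) powr (real (n div 10) + 1)"
    proof (rule powr_mono)
      have "n \<le> 10 * (n div 10) + 9" by presburger
      thus "real n / 10 \<le> real (n div 10) + 1" by linarith
    qed simp
    also have "\<dots> = (4 / 3) ^ (n div 10) * (4 / 3)" by (simp add: powr_add powr_realpow)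
    finally show ?thesis by simp
  qed
  hence e: "10 * r * (3 * r) ^ t \<le> (4 / 3) ^ (n div 10)" using yt by linarith
  have "10 * real (n choose t) * real n \<le> 10 * (3 * r) ^ t * real n"
    using choose_le_ratio_power[of t n] t by (intro mult_right_mono) (auto simp: r_def)
  also have "\<dots> = real t * (10 * r * (3 * r) ^ t)" by (simp add: r(2))
  also have "\<dots> \<le> real t * (4 / 3) ^ (n div 10)" by (rule mult_left_mono[OF e]) simp
  finally show ?thesis .
qed

lemma fact_diff_eq: 
  assumes "m \<ge> (2::nat)"
  shows "fact (m - 1) - fact (m - 2) = (m - 2) * (fact (m - 2) :: nat)"
proof -
  obtain l where l: "m = Suc (Suc l)" using assms by (metis add_2_eq_Suc le_Suc_ex)
  show ?thesis by (simp add: l)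
qed

text \<open>The exponent \<open>n div 10\<close> balances two effects: a longer decision tree has more steps, but the bound
\<open>3 / 4\<close> per step only holds while the tree has depth at most about \<open>n / 9\<close>.\<close>
lemma uncovered_bound:
  fixes n t :: nat
  assumes t: "t \<ge> 2" and n: "n \<ge> 400 * t"
  defines "D \<equiv> t * (fact (n - t - 1) - fact (n - t - 2))"
  shows "real ((n choose t) * fact (n - t)) * (3 / 4) ^ (n div 10) \<le> real D / 10"
proof -
  define N where "N = n - t"
  have N: "N \<ge> 4" "N + t = n" using t n by (auto simp: N_def)
  have D: "real D = real t * (real N - 2) * fact (N - 2)"
    using fact_diff_eq[of N] N by (simp add: D_def N_def[symmetric] of_nat_diff)
  have f: "fact N = real N * (real N - 1) * fact (N - 2)"
  proof -
    obtain l where l: "N = Suc (Suc l)" using N le_Suc_ex[of 2 N] by (auto simp: numeral_2_eq_2)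
    show ?thesis by (simp add: l algebra_simps)
  qed
  have NN: "real N * (real N - 1) \<le> (real N - 2) * real n"
  proof -
    have "real N * (real N - 1) \<le> (real N - 2) * (real N + 2)" using N by (simp add: algebra_simps)
    also have "\<dots> \<le> (real N - 2) * real n" by (rule mult_left_mono) (use N t in auto)
    finally show ?thesis .
  qed
  have p: "(4 / 3) ^ (n div 10) * (3 / 4 :: real) ^ (n div 10) = 1"
    by (simp add: power_mult_distrib[symmetric])
  have "10 * (real ((n choose t) * fact (n - t)) * (3 / 4) ^ (n div 10))
      = 10 * real (n choose t) * (real N * (real N - 1)) * fact (N - 2) * (3 / 4) ^ (n div 10)"
    by (simp add: N_def[symmetric] f algebra_simps)
  also have "\<dots> \<le> 10 * real (n choose t) * ((real N - 2) * real n) * fact (N - 2) * (3 / 4) ^ (n div 10)"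
    by (intro mult_right_mono mult_left_mono NN) auto
  also have "\<dots> = (10 * real (n choose t) * real n) * ((real N - 2) * fact (N - 2) * (3 / 4) ^ (n div 10))"
    by (simp only: ac_simps)
  also have "\<dots> \<le> (real t * (4 / 3) ^ (n div 10)) * ((real N - 2) * fact (N - 2) * (3 / 4) ^ (n div 10))"
    by (intro mult_right_mono choose_times_le_exponential[OF t n]) (use N in auto)
  also have "\<dots> = real D * ((4 / 3) ^ (n div 10) * (3 / 4) ^ (n div 10))"
    unfolding D by (simp only: ac_simps)
  also have "\<dots> = real D" unfolding p by simp
  finally show ?thesis by simp
qed

lemma peel_cost_halves:
  fixes n t c :: nat
  assumes c: "c \<ge> 2" "8 * (t + c + 1) \<le> n - t - c"
  shows "2 * peel_cost n t (Suc c) \<le> peel_cost n t c"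
proof -
  define M where "M = n - t - c"
  have M: "M \<ge> 1" using c by (simp add: M_def)
  define X where "X = real ((t + c) choose t) * real (c + 1) ^ c * fact (M - 1)"
  have X: "X \<ge> 0" by (simp add: X_def)
  have ch: "real (c + 1) * real ((t + Suc c) choose t) = real (t + c + 1) * real ((t + c) choose t)"
    using binomial_absorb_comp[of "t + Suc c" t]
    by (simp flip: of_nat_mult add: algebra_simps)
  have "real (c + 1) * real (2 * peel_cost n t (Suc c))
      = 2 * (real (c + 1) * real ((t + Suc c) choose t)) * (real (c + 2) * real (c + 2) ^ c) * fact (M - 1)"
    by (simp add: peel_cost_def M_def algebra_simps)
  also have "\<dots> = 2 * (real (t + c + 1) * real ((t + c) choose t)) * (real (c + 2) * real (c + 2) ^ c) * fact (M - 1)"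
    unfolding ch ..
  also have "\<dots> \<le> 2 * (real (t + c + 1) * real ((t + c) choose t)) * (real (c + 2) * (3 * real (c + 1) ^ c)) * fact (M - 1)"
    using succ_power_le[of c "c + 1"] by (intro mult_right_mono mult_left_mono) auto
  also have "\<dots> = (6 * real (t + c + 1) * real (c + 2)) * X" by (simp add: X_def)
  also have "\<dots> \<le> (real (c + 1) * real M) * X"
  proof (rule mult_right_mono[OF _ X])
    have "3 * (c + 2) \<le> 4 * (c + 1)" using c by simp
    hence "2 * (t + c + 1) * (3 * (c + 2)) \<le> 2 * (t + c + 1) * (4 * (c + 1))" by (rule mult_left_mono) simp
    also have "\<dots> = 8 * (t + c + 1) * (c + 1)" by (simp add: algebra_simps)
    also have "\<dots> \<le> M * (c + 1)" using c by (intro mult_right_mono) (auto simp: M_def)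
    finally have "6 * (t + c + 1) * (c + 2) \<le> (c + 1) * M" by (simp add: algebra_simps)
    hence "real (6 * (t + c + 1) * (c + 2)) \<le> real ((c + 1) * M)" by (simp only: of_nat_le_iff)
    thus "6 * real (t + c + 1) * real (c + 2) \<le> real (c + 1) * real M" by (simp only: of_nat_mult of_nat_numeral)
  qed
  also have "\<dots> = real (c + 1) * real (peel_cost n t c)"
  proof -
    have "fact M = real M * fact (M - 1)" using M by (cases M) auto
    moreover have "real (peel_cost n t c) = real ((t + c) choose t) * real (c + 1) ^ c * fact M"
      by (simp add: peel_cost_def M_def)
    ultimately show ?thesis by (simp add: X_def)
  qed
  finally have "real (2 * peel_cost n t (Suc c)) \<le> real (peel_cost n t c)" by simp
  thus ?thesis by (simp only: of_nat_le_iff)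
qed

lemma sum_peel_cost:
  fixes n t k :: nat
  assumes "8 * (t + k) \<le> n - t - k" "c \<ge> 2" "c \<le> k"
  shows "(\<Sum>j\<in>{c..k}. peel_cost n t j) \<le> 2 * peel_cost n t c"
  using assms(3,2)
proof (induction rule: inc_induct)
  case (step c)
  have "(\<Sum>j\<in>{c..k}. peel_cost n t j) = peel_cost n t c + (\<Sum>j\<in>{Suc c..k}. peel_cost n t j)"
    using step by (simp add: sum.atLeast_Suc_atMost)
  also have "\<dots> \<le> peel_cost n t c + 2 * peel_cost n t (Suc c)" using step by simp
  also have "\<dots> \<le> 2 * peel_cost n t c"
    using peel_cost_halves[of c t n] step assms(1) by simp
  finally show ?case .
qed simp

lemma peel_bound:
  fixes n t :: nat
  assumes t: "t \<ge> 2" and n: "n \<ge> 400 * t"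
  defines "D \<equiv> t * (fact (n - t - 1) - fact (n - t - 2))"
  shows "real (\<Sum>j\<in>{2..n div 10}. peel_cost n t j) \<le> real D / 10"
proof -
  define N where "N = n - t"
  have N: "N \<ge> 399 * t" using n by (simp add: N_def)
  have k: "10 * (n div 10) \<le> n" by simp
  have "9 * t + 9 * (n div 10) \<le> n" using n k by linarith
  hence "8 * (t + n div 10) + (t + n div 10) \<le> n" by simp
  hence "8 * (t + n div 10) \<le> n - t - n div 10" unfolding diff_diff_left by (rule add_le_imp_le_diff)
  moreover have "2 \<le> n div 10" using n t by simp
  ultimately have "(\<Sum>j\<in>{2..n div 10}. peel_cost n t j) \<le> 2 * peel_cost n t 2"
    using sum_peel_cost[of t "n div 10" n 2] by simp
  also have "\<dots> = 9 * ((t + 1) * (t + 2)) * fact (N - 2)"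
  proof -
    have "2 * ((t + 2) choose t) = (t + 1) * (t + 2)"
      using binomial_symmetric[of t "t + 2"] by (simp add: choose_two)
    moreover have "2 * peel_cost n t 2 = 2 * ((t + 2) choose t) * 9 * fact (N - 2)"
      by (simp add: peel_cost_def N_def)
    ultimately show ?thesis by simp
  qed
  finally have "10 * (\<Sum>j\<in>{2..n div 10}. peel_cost n t j) \<le> 10 * (9 * ((t + 1) * (t + 2)) * fact (N - 2))"
    by (rule mult_left_mono) simp
  also have "\<dots> = 90 * ((t + 1) * (t + 2)) * fact (N - 2)" by (simp only: mult.assoc[symmetric])
  also have "\<dots> \<le> t * (N - 2) * fact (N - 2)"
  proof (rule mult_right_mono)
    have "(t + 1) * (t + 2) \<le> 3 * (t * t)"
    proof -
      have "2 * t \<le> t * t" using t by simp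
      moreover have "4 \<le> t * t" using mult_le_mono[OF t t] by simp
      moreover have "(t + 1) * (t + 2) = t * t + 3 * t + 2" by (simp add: algebra_simps)
      ultimately show ?thesis using t by linarith
    qed
    hence "90 * ((t + 1) * (t + 2)) \<le> t * (270 * t)" by simp
    also have "\<dots> \<le> t * (N - 2)" using N t by (intro mult_left_mono) auto
    finally show "90 * ((t + 1) * (t + 2)) \<le> t * (N - 2)" .
  qed simp
  also have "\<dots> = D"
    using fact_diff_eq[of N] N t by (simp add: D_def N_def[symmetric])
  finally have "10 * (\<Sum>j\<in>{2..n div 10}. peel_cost n t j) \<le> D" .
  hence "real (10 * (\<Sum>j\<in>{2..n div 10}. peel_cost n t j)) \<le> real D" by (simp only: of_nat_le_iff)
  thus ?thesis by simp
qed

section \<open>Cross-intersecting families of sets of size t + 1\<close>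
lemma contains_or_misses_one:
  assumes c: "card A = t + 1" "card B1 = t + 1" "card B2 = t + 1" "card (B1 \<inter> B2) = t"
    and fin: "finite A" "finite B1" "finite B2"
    and i: "t \<le> card (A \<inter> B1)" "t \<le> card (A \<inter> B2)"
    and y: "y \<in> B1 \<inter> B2" "y \<notin> A"
  shows "A = (B1 \<union> B2) - {y}"
proof -
  have cu: "card (B1 \<union> B2) = t + 2" using card_Un_Int[OF fin(2,3)] c by simp
  have one: "A \<inter> B = B - {y}" if "finite B" "card B = t + 1" "t \<le> card (A \<inter> B)" "y \<in> B" for B
    by (rule card_seteq) (use that y in auto)
  have "A \<inter> B1 = B1 - {y}" by (rule one[OF fin(2) c(2) i(1)]) (use y in blast)
  moreover have "A \<inter> B2 = B2 - {y}" by (rule one[OF fin(3) c(3) i(2)]) (use y in blast)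
  ultimately have sub: "(B1 \<union> B2) - {y} \<subseteq> A" by blast
  have "card ((B1 \<union> B2) - {y}) = t + 1" using cu fin y by simp
  thus ?thesis using card_subset_eq[OF fin(1) sub] c by simp
qed

text \<open>The trace of large diversity on the covers: no \<open>t\<close>-set is contained in all but at most one of them.\<close>
definition twice_missed :: "nat \<Rightarrow> 'a set \<Rightarrow> 'a set set \<Rightarrow> bool" where
  "twice_missed t U \<A> \<longleftrightarrow> (\<forall>S\<subseteq>U. card S = t \<longrightarrow>
     (\<exists>A1\<in>\<A>. \<exists>A2\<in>\<A>. A1 \<noteq> A2 \<and> \<not> S \<subseteq> A1 \<and> \<not> S \<subseteq> A2))"

lemma twice_missedE:
  assumes "twice_missed t U \<A>" "S \<subseteq> U" "card S = t"
  obtains A1 A2 where "A1 \<in> \<A>" "A2 \<in> \<A>" "A1 \<noteq> A2" "\<not> S \<subseteq> A1" "\<not> S \<subseteq> A2"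
proof -
  have "\<exists>A1\<in>\<A>. \<exists>A2\<in>\<A>. A1 \<noteq> A2 \<and> \<not> S \<subseteq> A1 \<and> \<not> S \<subseteq> A2"
    using assms unfolding twice_missed_def by simp
  thus thesis by (elim bexE conjE) (rule that)
qed

text \<open>Write \<open>S\<close> and \<open>T\<close> for the intersection and the union of \<open>B1\<close> and \<open>B2\<close>. A member of \<open>\<A>\<close> either
contains \<open>S\<close> or is \<open>T\<close> minus one point of \<open>S\<close>, and there are at least two of the latter kind.
If some member were \<open>S\<close> plus a point outside \<open>T\<close>, then these three members of \<open>\<A>\<close> would force all
members of \<open>\<B>\<close> to contain \<open>S\<close>, against the hypothesis on \<open>\<B>\<close>.\<close>
lemma near_pair_confines:
  assumes \<A>: "\<And>A. A \<in> \<A> \<Longrightarrow> A \<subseteq> U \<and> card A = t + 1" and \<B>: "\<And>B. B \<in> \<B> \<Longrightarrow> B \<subseteq> U \<and> card B = t + 1"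
    and U: "finite U" and cr: "cross_sets t \<A> \<B>"
    and tA: "twice_missed t U \<A>" and tB: "twice_missed t U \<B>"
    and B: "B1 \<in> \<B>" "B2 \<in> \<B>" "card (B1 \<inter> B2) = t"
  shows "(\<forall>A\<in>\<A>. A \<subseteq> B1 \<union> B2) \<and>
    (\<exists>A1\<in>\<A>. \<exists>A2\<in>\<A>. card (A1 \<inter> A2) = t \<and> A1 \<union> A2 = B1 \<union> B2)"
proof -
  let ?S = "B1 \<inter> B2" and ?T = "B1 \<union> B2"
  have fin: "finite A" if "A \<in> \<A> \<union> \<B>" for A
  proof (rule finite_subset[OF _ U])
    show "A \<subseteq> U" using that \<A>[of A] \<B>[of A] by auto
  qed
  have cAB: "t \<le> card (A \<inter> B)" "t \<le> card (B \<inter> A)" if "A \<in> \<A>" "B \<in> \<B>" for A B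
    using cr that by (auto simp: cross_sets_def Int_commute)
  have SU: "?S \<subseteq> U" using \<B> B by blast
  have cT: "card ?T = t + 2" using card_Un_Int[of B1 B2] fin B \<B> by simp
  have fT: "finite ?T" using fin B by blast
  have dich: "A = ?T - {y}" if "A \<in> \<A>" "y \<in> ?S" "y \<notin> A" for A y
    by (rule contains_or_misses_one[where t = t]) (use that \<A> \<B> B fin cAB in auto)
  obtain A1 A2 where A: "A1 \<in> \<A>" "A2 \<in> \<A>" "A1 \<noteq> A2" "\<not> ?S \<subseteq> A1" "\<not> ?S \<subseteq> A2"
    by (rule twice_missedE[OF tA SU B(3)])
  obtain y1 where y1: "y1 \<in> ?S" "y1 \<notin> A1" using A by blast
  obtain y2 where y2: "y2 \<in> ?S" "y2 \<notin> A2" using A by blast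
  have A12: "A1 = ?T - {y1}" "A2 = ?T - {y2}" using dich A y1 y2 by blast+
  have yne: "y1 \<noteq> y2" using A12 A(3) by auto
  have S': "A1 \<inter> A2 = ?T - {y1, y2}" "A1 \<union> A2 = ?T" using A12 yne y1 y2 by auto
  have cS': "card (A1 \<inter> A2) = t" unfolding S' using cT fT y1 y2 yne by simp
  have "A \<subseteq> ?T" if A': "A \<in> \<A>" for A
  proof (rule ccontr)
    assume nT: "\<not> A \<subseteq> ?T"
    hence SA: "?S \<subseteq> A" using dich[OF A'] by blast
    obtain z where z: "z \<in> A" "z \<notin> ?T" using nT by blast
    have Az: "A = insert z ?S"
    proof (rule sym, rule card_subset_eq)
      show "finite A" using fin A' by blast
      show "insert z ?S \<subseteq> A" using SA z by blast
      have "z \<notin> ?S" using z by blast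
      moreover have "finite ?S" using fin B by blast
      ultimately show "card (insert z ?S) = card A" using B(3) \<A>[OF A'] by simp
    qed
    have "?S \<subseteq> B" if B': "B \<in> \<B>" for B
    proof (rule ccontr)
      assume "\<not> ?S \<subseteq> B"
      then obtain s where s: "s \<in> ?S" "s \<notin> B" by blast
      have "A \<inter> B = A - {s}"
        by (rule card_seteq) (use cAB[OF A' B'] fin A' \<A>[OF A'] SA s in auto)
      hence zB: "z \<in> B" and sB: "?S - {s} \<subseteq> B" using z s SA by blast+
      have dB: "B = (A1 \<union> A2) - {y}" if "y \<in> A1 \<inter> A2" "y \<notin> B" for y
        by (rule contains_or_misses_one[where t = t]) (use that A \<A> \<B>[OF B'] B' cS' fin cAB in auto)
      have "A1 \<inter> A2 \<subseteq> B" using dB zB z S'(2) by blast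
      hence "insert z (A1 \<inter> A2) \<subseteq> B" using zB by blast
      moreover have "card (insert z (A1 \<inter> A2)) = card B"
      proof -
        have "z \<notin> A1 \<inter> A2" using z S' by blast
        moreover have "finite (A1 \<inter> A2)" using fin A by blast
        ultimately show ?thesis using cS' \<B>[OF B'] by simp
      qed
      ultimately have "B = insert z (A1 \<inter> A2)" using card_subset_eq fin B' by (metis UnI2)
      hence "y1 \<notin> B" "y2 \<notin> B" using z y1 y2 S'(1) by auto
      hence "y1 = s" "y2 = s" using sB y1 y2 by blast+
      thus False using yne by simp
    qed
    thus False using twice_missedE[OF tB SU B(3)] by metis
  qed
  thus ?thesis using A(1,2) cS' S'(2) by blast
qed

text \<open>It remains to find two members of the same family that share exactly \<open>t\<close> points. If two members of
\<open>\<B>\<close> share only a set \<open>K\<close> of \<open>t - 1\<close> points, then every member of \<open>\<A>\<close> contains \<open>K\<close>, and two members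
of \<open>\<A>\<close> that omit the same point of \<open>B1 - K\<close> have a common further point in \<open>B1\<close>.\<close>
lemma confined_to_core:
  assumes \<A>: "\<And>A. A \<in> \<A> \<Longrightarrow> A \<subseteq> U \<and> card A = t + 1" and \<B>: "\<And>B. B \<in> \<B> \<Longrightarrow> B \<subseteq> U \<and> card B = t + 1"
    and U: "finite U" and cr: "cross_sets t \<A> \<B>" and ne: "\<A> \<noteq> {}" and t: "t \<ge> 1"
    and tA: "twice_missed t U \<A>" and tB: "twice_missed t U \<B>"
  obtains T where "T \<subseteq> U" "card T = t + 2" "\<And>A. A \<in> \<A> \<Longrightarrow> A \<subseteq> T" "\<And>B. B \<in> \<B> \<Longrightarrow> B \<subseteq> T"
proof -
  note thesis_core = that
  have fin: "finite A" if "A \<in> \<A> \<union> \<B>" for A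
  proof (rule finite_subset[OF _ U])
    show "A \<subseteq> U" using that \<A>[of A] \<B>[of A] by auto
  qed
  have crs: "cross_sets t \<B> \<A>" using cr cross_sets_sym by blast
  have cAB: "t \<le> card (A \<inter> B)" if "A \<in> \<A>" "B \<in> \<B>" for A B
    using cr that by (auto simp: cross_sets_def)
  have *: thesis if B: "B1 \<in> \<B>" "B2 \<in> \<B>" "card (B1 \<inter> B2) = t" for B1 B2
  proof -
    have n: "(\<forall>A\<in>\<A>. A \<subseteq> B1 \<union> B2) \<and>
      (\<exists>A1\<in>\<A>. \<exists>A2\<in>\<A>. card (A1 \<inter> A2) = t \<and> A1 \<union> A2 = B1 \<union> B2)"
      by (rule near_pair_confines[OF \<A> \<B> U cr tA tB B])
    then obtain A1 A2 where A: "A1 \<in> \<A>" "A2 \<in> \<A>" "card (A1 \<inter> A2) = t" "A1 \<union> A2 = B1 \<union> B2" by blast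
    have b: "\<forall>B\<in>\<B>. B \<subseteq> B1 \<union> B2"
      using near_pair_confines[OF \<B> \<A> U crs tB tA A(1-3)] A(4) by simp
    have c: "card (B1 \<union> B2) = t + 2" using card_Un_Int[of B1 B2] fin B \<B> by simp
    have u: "B1 \<union> B2 \<subseteq> U" using \<B>[OF B(1)] \<B>[OF B(2)] by simp
    show thesis
      by (rule thesis_core[OF u c]) (use n b in simp_all)
  qed
  have **: thesis if A: "A1 \<in> \<A>" "A2 \<in> \<A>" "card (A1 \<inter> A2) = t" for A1 A2
  proof -
    obtain B1 B2 where "B1 \<in> \<B>" "B2 \<in> \<B>" "card (B1 \<inter> B2) = t"
      using near_pair_confines[OF \<B> \<A> U crs tB tA A] by blast
    thus thesis by (rule *)
  qed
  obtain A0 where A0: "A0 \<in> \<A>" using ne by blast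
  obtain S where "S \<subseteq> A0" "card S = t" using obtain_subset_with_card_n[of t A0] \<A>[OF A0] by auto
  moreover have "A0 \<subseteq> U" using \<A>[OF A0] by blast
  ultimately obtain B1 B2 where B: "B1 \<in> \<B>" "B2 \<in> \<B>" "B1 \<noteq> B2"
    using twice_missedE[OF tB, of S] by (metis subset_trans)
  let ?K = "B1 \<inter> B2"
  have Kint: "t \<le> card (A \<inter> ?K) + 1" if "A \<in> \<A>" for A
  proof -
    have "card ((A \<inter> B1) \<union> (A \<inter> B2)) + card ((A \<inter> B1) \<inter> (A \<inter> B2)) = card (A \<inter> B1) + card (A \<inter> B2)"
      using card_Un_Int[of "A \<inter> B1" "A \<inter> B2"] fin that by simp
    moreover have "card ((A \<inter> B1) \<union> (A \<inter> B2)) \<le> t + 1"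
      using card_mono[of A "(A \<inter> B1) \<union> (A \<inter> B2)"] fin that \<A>[OF that] by auto
    moreover have "(A \<inter> B1) \<inter> (A \<inter> B2) = A \<inter> ?K" by blast
    ultimately show ?thesis using cAB[OF that B(1)] cAB[OF that B(2)] by simp
  qed
  have fK: "finite ?K" using fin B by blast
  have K1: "t \<le> card ?K + 1" using Kint[OF A0] card_mono[OF fK Int_lower2[of A0 ?K]] by linarith
  have "?K \<noteq> B1"
  proof
    assume "?K = B1"
    hence "B1 \<subseteq> B2" by blast
    thus False using card_subset_eq[of B2 B1] fin B \<B> by auto
  qed
  hence K2: "card ?K < t + 1" using psubset_card_mono[of B1 ?K] fin B \<B>[OF B(1)] by auto
  show thesis
  proof (cases "card ?K = t")
    case True
    thus ?thesis using * B by blast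
  next
    case False
    hence cK: "card ?K + 1 = t" using K1 K2 by simp
    have KA: "?K \<subseteq> A" if "A \<in> \<A>" for A
    proof -
      have "A \<inter> ?K = ?K" by (rule card_seteq[OF fK]) (use Kint[OF that] cK in auto)
      thus ?thesis by blast
    qed
    have "\<not> B1 \<subseteq> ?K" using \<open>?K \<noteq> B1\<close> by blast
    then obtain a where a: "a \<in> B1" "a \<notin> ?K" by blast
    have "insert a ?K \<subseteq> U" using a \<B>[OF B(1)] by blast
    moreover have "card (insert a ?K) = t" using a(2) fK cK by simp
    ultimately obtain A1 A2 where A: "A1 \<in> \<A>" "A2 \<in> \<A>" "A1 \<noteq> A2" "\<not> insert a ?K \<subseteq> A1" "\<not> insert a ?K \<subseteq> A2"
      by (rule twice_missedE[OF tA])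
    have aA: "a \<notin> A1" "a \<notin> A2" using A KA by blast+
    have "B1 - {a} \<subseteq> A'" if "A' \<in> \<A>" "a \<notin> A'" for A'
    proof -
      have "A' \<inter> B1 = B1 - {a}"
        by (rule card_seteq) (use cAB[OF that(1) B(1)] fin B \<B>[OF B(1)] a that in auto)
      thus ?thesis by blast
    qed
    hence sub: "B1 - {a} \<subseteq> A1 \<inter> A2" using A aA by blast
    have fA: "finite (A1 \<inter> A2)" using fin A by blast
    have "t \<le> card (A1 \<inter> A2)"
      using card_mono[OF fA sub] fin B \<B>[OF B(1)] a by simp
    moreover have "card (A1 \<inter> A2) < t + 1"
    proof -
      have "A1 \<inter> A2 \<noteq> A1"
      proof
        assume "A1 \<inter> A2 = A1"
        hence "A1 \<subseteq> A2" by blast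
        thus False using card_subset_eq[of A2 A1] fin A \<A> by auto
      qed
      thus ?thesis using psubset_card_mono[of A1 "A1 \<inter> A2"] fin A \<A>[OF A(1)] by auto
    qed
    ultimately have "card (A1 \<inter> A2) = t" by simp
    thus ?thesis using ** A by blast
  qed
qed

section \<open>Diversity and the extremal family\<close>
lemma diversity_le_card_missing:
  assumes F: "F \<subseteq> Sym n" and S: "S \<subseteq> {1..n} \<times> {1..n}" "card S = t"
  shows "diversity n t F \<le> card {\<sigma> \<in> F. \<not> S \<subseteq> perm_graph n \<sigma>}"
proof -
  have finF: "finite F" using F finite_Sym finite_subset by blast
  have "card {\<sigma> \<in> F. S \<subseteq> perm_graph n \<sigma>} \<le> max_degree n t F"
    unfolding max_degree_def
  proof (rule Max_ge)
    have "finite {S. S \<subseteq> {1..n} \<times> {1..n} \<and> card S = t}"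
      by (rule finite_subset[of _ "Pow ({1..n} \<times> {1..n})"]) auto
    thus "finite ((\<lambda>S. card {\<sigma> \<in> F. S \<subseteq> perm_graph n \<sigma>}) `
        {S. S \<subseteq> {1..n} \<times> {1..n} \<and> card S = t})" by (rule finite_imageI)
  qed (use S in blast)
  moreover have "card F = card {\<sigma> \<in> F. S \<subseteq> perm_graph n \<sigma>} + card {\<sigma> \<in> F. \<not> S \<subseteq> perm_graph n \<sigma>}"
  proof -
    have "F = {\<sigma> \<in> F. S \<subseteq> perm_graph n \<sigma>} \<union> {\<sigma> \<in> F. \<not> S \<subseteq> perm_graph n \<sigma>}" by blast
    hence "card F = card ({\<sigma> \<in> F. S \<subseteq> perm_graph n \<sigma>} \<union> {\<sigma> \<in> F. \<not> S \<subseteq> perm_graph n \<sigma>})"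
      by (rule arg_cong)
    also have "\<dots> = card {\<sigma> \<in> F. S \<subseteq> perm_graph n \<sigma>} + card {\<sigma> \<in> F. \<not> S \<subseteq> perm_graph n \<sigma>}"
      by (rule card_Un_disjoint) (use finF in auto)
    finally show ?thesis .
  qed
  ultimately show ?thesis by (simp add: diversity_def)
qed

lemma extend_to_permutation:
  assumes h: "inj_on h A" "A \<subseteq> {1..n::nat}" "h ` A \<subseteq> {1..n}"
  obtains \<pi> where "\<pi> permutes {1..n}" "\<And>a. a \<in> A \<Longrightarrow> \<pi> a = h a"
proof -
  have fA: "finite A" using h finite_subset by blast
  have "card ({1..n} - A) = card ({1..n} - h ` A)"
    using h fA by (simp add: card_Diff_subset card_image)
  then obtain g where g: "bij_betw g ({1..n} - A) ({1..n} - h ` A)"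
    using finite_same_card_bij[of "{1..n} - A" "{1..n} - h ` A"] by auto
  define \<pi> where "\<pi> x = (if x \<in> A then h x else if x \<in> {1..n} then g x else x)" for x
  have "bij_betw \<pi> A (h ` A)"
    using h(1) by (auto simp: bij_betw_def \<pi>_def inj_on_def)
  moreover have "bij_betw \<pi> ({1..n} - A) ({1..n} - h ` A)"
    using g by (subst bij_betw_cong[of _ _ g]) (auto simp: \<pi>_def)
  ultimately have "bij_betw \<pi> (A \<union> ({1..n} - A)) (h ` A \<union> ({1..n} - h ` A))"
    by (rule bij_betw_combine) blast
  moreover have "A \<union> ({1..n} - A) = {1..n}" "h ` A \<union> ({1..n} - h ` A) = {1..n}" using h by auto
  ultimately have "\<pi> permutes {1..n}"
    by (intro bij_imp_permutes) (use h in \<open>auto simp: \<pi>_def\<close>)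
  thus thesis using that by (auto simp: \<pi>_def)
qed

text \<open>For \<open>m = t + 1\<close> and a partial permutation \<open>T\<close> of size \<open>t + 2\<close>, these are the isomorphic copies of
\<open>F1 n t\<close>.\<close>
definition near_family :: "nat \<Rightarrow> nat \<Rightarrow> (nat \<times> nat) set \<Rightarrow> (nat \<Rightarrow> nat) set" where
  "near_family n m T = {\<sigma> \<in> Sym n. m \<le> card (T \<inter> perm_graph n \<sigma>)}"

lemma partial_perm_criterion:
  assumes T: "T \<subseteq> {1..n} \<times> {1..n}" "inj_on fst T" "inj_on snd T"
  shows "T \<in> partial_perms n"
proof -
  let ?g = "the_inv_into T fst"
  have g: "?g (fst x) = x" if "x \<in> T" for x using the_inv_into_f_f[OF T(2) that] .
  have "inj_on (\<lambda>i. snd (?g i)) (fst ` T)"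
  proof (rule inj_onI, clarify)
    fix i j i' j' assume x: "(i, j) \<in> T" and y: "(i', j') \<in> T" and "snd (?g (fst (i, j))) = snd (?g (fst (i', j')))"
    hence "snd (i, j) = snd (i', j')" using g[OF x] g[OF y] by simp
    hence "(i, j) = (i', j')" using T(3) x y by (meson inj_onD)
    thus "fst (i, j) = fst (i', j')" by simp
  qed
  moreover have "fst ` T \<subseteq> {1..n}" using T by auto
  moreover have "(\<lambda>i. snd (?g i)) ` fst ` T \<subseteq> {1..n}"
  proof clarify
    fix i j assume x: "(i, j) \<in> T"
    hence "snd (?g (fst (i, j))) = j" using g[OF x] by simp
    thus "snd (?g (fst (i, j))) \<in> {1..n}" using x T by auto
  qed
  ultimately obtain \<pi> where p: "\<pi> permutes {1..n}" "\<And>i. i \<in> fst ` T \<Longrightarrow> \<pi> i = snd (?g i)"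
    using extend_to_permutation[of "\<lambda>i. snd (?g i)" "fst ` T" n] by blast
  have "T \<subseteq> perm_graph n \<pi>"
  proof
    fix x assume x: "x \<in> T"
    hence "\<pi> (fst x) = snd x" using p(2)[of "fst x"] g[OF x] by simp
    thus "x \<in> perm_graph n \<pi>" using x T by (cases x) (auto simp: mem_perm_graph)
  qed
  hence "\<pi> \<in> coset n T" using p by (simp add: coset_def Sym_def)
  thus ?thesis by (auto simp: partial_perms_def)
qed

text \<open>Enumerate \<open>T\<close> by \<open>1, \<dots>, t + 2\<close>. Choosing \<open>\<pi>\<close> to list the rows of \<open>T\<close>, and \<open>\<rho>\<close> to undo
\<open>\<pi>\<close> after a permutation through \<open>T\<close>, moves the cells of \<open>T\<close> onto the diagonal.\<close>
lemma near_family_isomorphic: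
  assumes T: "T \<in> partial_perms n" "card T = t + 2"
  shows "isomorphic_families n (near_family n (t + 1) T) (F1 n t)"
proof -
  obtain \<sigma>0 where s0: "\<sigma>0 permutes {1..n}" "T \<subseteq> perm_graph n \<sigma>0"
    using T by (auto simp: partial_perms_def coset_def Sym_def)
  have fT: "finite T" using T partial_perm_finite by blast
  obtain e where e: "bij_betw e {1..t + 2} T"
    using ex_bij_betw_nat_finite_1[OF fT] T(2) by auto
  have tn: "t + 2 \<le> n"
  proof -
    have "fst ` T \<subseteq> {1..n}" using s0 by (auto simp: perm_graph_def)
    thus ?thesis using card_mono[of "{1..n}" "fst ` T"] card_rows[OF s0(2)] T(2) by simp
  qed
  have eT: "e k \<in> T" if "k \<in> {1..t + 2}" for k using e that by (auto simp: bij_betw_def)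
  have ge: "fst (e k) \<in> {1..n}" "snd (e k) = \<sigma>0 (fst (e k))" if "k \<in> {1..t + 2}" for k
    using eT[OF that] s0(2) by (auto simp: perm_graph_def)
  have "inj_on (\<lambda>k. fst (e k)) {1..t + 2}"
  proof (rule inj_onI)
    fix k l assume k: "k \<in> {1..t + 2}" and l: "l \<in> {1..t + 2}" and f: "fst (e k) = fst (e l)"
    hence "e k = e l" using ge[OF k] ge[OF l] by (simp add: prod_eq_iff)
    thus "k = l" using e k l by (auto simp: bij_betw_def inj_on_def)
  qed
  moreover have "{1..t + 2} \<subseteq> {1..n}" using tn by auto
  moreover have "(\<lambda>k. fst (e k)) ` {1..t + 2} \<subseteq> {1..n}" using ge(1) by blast
  ultimately obtain \<pi> where p: "\<pi> permutes {1..n}" "\<And>k. k \<in> {1..t + 2} \<Longrightarrow> \<pi> k = fst (e k)"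
    using extend_to_permutation[of "\<lambda>k. fst (e k)" "{1..t + 2}" n] by metis
  define \<rho> where "\<rho> = inv \<pi> \<circ> inv \<sigma>0"
  have r: "\<rho> permutes {1..n}" unfolding \<rho>_def
    using permutes_compose permutes_inv p(1) s0(1) by blast
  have fix_iff: "(\<rho> \<circ> \<sigma> \<circ> \<pi>) k = k \<longleftrightarrow> e k \<in> perm_graph n \<sigma>" if "k \<in> {1..t + 2}" for \<sigma> k
  proof -
    have "(\<rho> \<circ> \<sigma> \<circ> \<pi>) k = k \<longleftrightarrow> \<sigma> (\<pi> k) = \<sigma>0 (\<pi> k)"
      unfolding \<rho>_def using p(1) s0(1) by (metis comp_apply permutes_inverses(1,2))
    also have "\<dots> \<longleftrightarrow> e k \<in> perm_graph n \<sigma>"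
      using ge[OF that] p(2)[OF that] by (cases "e k") (auto simp: mem_perm_graph)
    finally show ?thesis .
  qed
  have cnt: "card {j \<in> {1..t + 2}. (\<rho> \<circ> \<sigma> \<circ> \<pi>) j = j} = card (T \<inter> perm_graph n \<sigma>)" for \<sigma>
  proof -
    have "e ` {j \<in> {1..t + 2}. (\<rho> \<circ> \<sigma> \<circ> \<pi>) j = j} = T \<inter> perm_graph n \<sigma>"
    proof (intro set_eqI iffI)
      fix x assume "x \<in> T \<inter> perm_graph n \<sigma>"
      moreover from this obtain k where "k \<in> {1..t + 2}" "x = e k" using e by (auto simp: bij_betw_def)
      ultimately show "x \<in> e ` {j \<in> {1..t + 2}. (\<rho> \<circ> \<sigma> \<circ> \<pi>) j = j}" using fix_iff by blast
    qed (use fix_iff eT in blast)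
    moreover have "inj_on e {j \<in> {1..t + 2}. (\<rho> \<circ> \<sigma> \<circ> \<pi>) j = j}"
      by (rule inj_on_subset[OF bij_betw_imp_inj_on[OF e]]) blast
    ultimately show ?thesis using card_image by fastforce
  qed
  have "F1 n t = {\<rho> \<circ> \<sigma> \<circ> \<pi> |\<sigma>. \<sigma> \<in> near_family n (t + 1) T}"
  proof (intro set_eqI iffI)
    fix \<phi> assume f: "\<phi> \<in> F1 n t"
    define \<sigma> where "\<sigma> = inv \<rho> \<circ> \<phi> \<circ> inv \<pi>"
    have eq: "\<rho> \<circ> \<sigma> \<circ> \<pi> = \<phi>" unfolding \<sigma>_def
      using r p(1) by (simp add: fun_eq_iff permutes_inverses)
    have "\<phi> permutes {1..n}" using f by (simp add: F1_def Sym_def)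
    hence "\<sigma> permutes {1..n}" unfolding \<sigma>_def
      using permutes_compose permutes_inv r p(1) by blast
    moreover have "t + 1 \<le> card (T \<inter> perm_graph n \<sigma>)"
      using f cnt[of \<sigma>] unfolding eq by (simp add: F1_def)
    ultimately have "\<sigma> \<in> near_family n (t + 1) T" by (simp add: near_family_def Sym_def)
    thus "\<phi> \<in> {\<rho> \<circ> \<sigma> \<circ> \<pi> |\<sigma>. \<sigma> \<in> near_family n (t + 1) T}" using eq by blast
  next
    fix \<phi> assume "\<phi> \<in> {\<rho> \<circ> \<sigma> \<circ> \<pi> |\<sigma>. \<sigma> \<in> near_family n (t + 1) T}"
    then obtain \<sigma> where s: "\<phi> = \<rho> \<circ> \<sigma> \<circ> \<pi>" "\<sigma> \<in> near_family n (t + 1) T" by blast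
    have "\<sigma> permutes {1..n}" using s(2) by (simp add: near_family_def Sym_def)
    hence "\<phi> permutes {1..n}" unfolding s(1) by (intro permutes_compose[OF p(1)] permutes_compose[OF _ r])
    moreover have "t + 1 \<le> card {j \<in> {1..t + 2}. \<phi> j = j}"
      using s(2) cnt[of \<sigma>] unfolding s(1) by (simp add: near_family_def)
    ultimately show "\<phi> \<in> F1 n t" by (simp add: F1_def Sym_def)
  qed
  thus ?thesis using r p(1) unfolding isomorphic_families_def Sym_def by blast
qed

text \<open>A \<open>t\<close>-subset \<open>S\<close> of \<open>T\<close> witnesses the bound: a member that does not contain \<open>S\<close> misses exactly one
cell of \<open>T\<close>, and this cell lies in \<open>S\<close>.\<close>
lemma near_family_diversity:
  assumes T: "T \<in> partial_perms n" "card T = t + 2" and F: "F \<subseteq> near_family n (t + 1) T"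
  shows "diversity n t F \<le> t * (fact (n - t - 1) - fact (n - t - 2))"
proof -
  have fT: "finite T" and TU: "T \<subseteq> {1..n} \<times> {1..n}" using T partial_perm_finite by blast+
  obtain S where S: "S \<subseteq> T" "card S = t" using obtain_subset_with_card_n[of t T] T by auto
  have fS: "finite S" using S fT finite_subset by blast
  have FS: "F \<subseteq> Sym n" using F by (auto simp: near_family_def)
  have sub: "{\<sigma> \<in> F. \<not> S \<subseteq> perm_graph n \<sigma>} \<subseteq> (\<Union>y\<in>S. coset n (T - {y}) - coset n T)"
  proof
    fix \<sigma> assume s: "\<sigma> \<in> {\<sigma> \<in> F. \<not> S \<subseteq> perm_graph n \<sigma>}"
    then obtain y where y: "y \<in> S" "y \<notin> perm_graph n \<sigma>" by blast
    have sS: "\<sigma> \<in> Sym n" using s FS by blast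
    have "card (T - {y}) = t + 1" using fT T(2) S(1) y(1) by auto
    moreover have "t + 1 \<le> card (T \<inter> perm_graph n \<sigma>)" using s F by (auto simp: near_family_def)
    ultimately have "T \<inter> perm_graph n \<sigma> = T - {y}"
      by (intro card_seteq) (use y fT in auto)
    hence "\<sigma> \<in> coset n (T - {y}) - coset n T" using sS y S by (auto simp: coset_def)
    thus "\<sigma> \<in> (\<Union>y\<in>S. coset n (T - {y}) - coset n T)" using y by blast
  qed
  have one: "card (coset n (T - {y}) - coset n T) = fact (n - t - 1) - fact (n - t - 2)" if "y \<in> S" for y
  proof -
    obtain \<sigma> where s: "\<sigma> \<in> Sym n" "T \<subseteq> perm_graph n \<sigma>"
      using T by (auto simp: partial_perms_def coset_def)
    have "card (coset n (T - {y}) - coset n T) = card (coset n (T - {y})) - card (coset n T)"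
      by (rule card_Diff_subset[OF finite_coset]) (auto simp: coset_def)
    moreover have "card (coset n T) = fact (n - t - 2)"
      using card_coset[OF s(2,1)] T(2) by (simp add: diff_diff_left)
    moreover have "card (coset n (T - {y})) = fact (n - t - 1)"
    proof -
      have "card (T - {y}) = t + 1" using fT T(2) that S by auto
      moreover have "T - {y} \<subseteq> perm_graph n \<sigma>" using s by blast
      ultimately show ?thesis using card_coset[OF _ s(1), of "T - {y}"] by (simp add: diff_diff_left)
    qed
    ultimately show ?thesis by simp
  qed
  have "diversity n t F \<le> card {\<sigma> \<in> F. \<not> S \<subseteq> perm_graph n \<sigma>}"
    by (rule diversity_le_card_missing[OF FS]) (use S TU in auto)
  also have "\<dots> \<le> card (\<Union>y\<in>S. coset n (T - {y}) - coset n T)"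
    by (rule card_mono[OF _ sub]) (use fS finite_coset in auto)
  also have "\<dots> \<le> (\<Sum>y\<in>S. card (coset n (T - {y}) - coset n T))" by (rule card_UN_le[OF fS])
  also have "\<dots> = t * (fact (n - t - 1) - fact (n - t - 2))" using one S by simp
  finally show ?thesis .
qed

section \<open>Diverse cross-intersecting families\<close>
lemma threshold_arith:
  fixes n t :: nat
  assumes t: "t \<ge> 2" and n: "n \<ge> 400 * t"
  defines "D \<equiv> t * (fact (n - t - 1) - fact (n - t - 2)) :: nat"
  shows "D > 0" "fact (n - t - 1) < 4 / 5 * real D"
    "real t * (3 / 4 * fact (n - t - 1)) < 4 / 5 * real D"
proof -
  define N where "N = n - t"
  have N: "N \<ge> 399 * t" "N \<ge> 798" using n t by (auto simp: N_def)
  have Dn: "D = t * ((N - 2) * fact (N - 2))"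
    using fact_diff_eq[of N] N t by (simp add: D_def N_def[symmetric])
  show "D > 0" using Dn t N by simp
  have D: "real D = real t * ((real N - 2) * fact (N - 2))"
    unfolding Dn using N by (simp add: of_nat_diff)
  have V: "fact (n - t - 1) = (real N - 1) * fact (N - 2)"
  proof -
    have "N - 1 = Suc (N - 2)" using N by simp
    hence "fact (N - 1) = real (N - 1) * fact (N - 2)" by (simp only: fact_Suc of_nat_mult)
    thus ?thesis using N by (simp add: N_def[symmetric] of_nat_diff)
  qed
  have c: "3 / 4 * ((real N - 1) * fact (N - 2)) < 4 / 5 * ((real N - 2) * fact (N - 2))"
  proof -
    have "3 / 4 * (real N - 1) < 4 / 5 * (real N - 2)" using N by simp
    hence "3 / 4 * (real N - 1) * fact (N - 2) < 4 / 5 * (real N - 2) * fact (N - 2)"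
      by (rule mult_strict_right_mono) simp
    thus ?thesis by (simp only: mult.assoc)
  qed
  have "real t * (3 / 4 * ((real N - 1) * fact (N - 2))) < real t * (4 / 5 * ((real N - 2) * fact (N - 2)))"
    by (rule mult_strict_left_mono[OF c]) (use t in simp)
  thus v: "real t * (3 / 4 * fact (n - t - 1)) < 4 / 5 * real D" unfolding V D by (simp only: ac_simps)
  have "fact (n - t - 1) \<le> 2 * (3 / 4 * fact (n - t - 1) :: real)" by simp
  also have "\<dots> \<le> real t * (3 / 4 * fact (n - t - 1))" by (rule mult_right_mono) (use t in auto)
  finally show "fact (n - t - 1) < 4 / 5 * real D" using v by linarith
qed

lemma missing_bound:
  assumes F: "F \<subseteq> Sym n" and S: "S \<subseteq> {1..n} \<times> {1..n}" "card S = t"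
    and D: "D \<le> diversity n t F" and sub: "{\<sigma> \<in> F. \<not> S \<subseteq> perm_graph n \<sigma>} \<subseteq> (F - spanned n \<A>) \<union> X"
    and X: "finite X"
  shows "D \<le> card (F - spanned n \<A>) + card X"
proof -
  have finF: "finite F" using F finite_Sym finite_subset by blast
  have "D \<le> card {\<sigma> \<in> F. \<not> S \<subseteq> perm_graph n \<sigma>}"
    using D diversity_le_card_missing[OF F S] by linarith
  also have "\<dots> \<le> card ((F - spanned n \<A>) \<union> X)" by (rule card_mono[OF _ sub]) (use finF X in auto)
  also have "\<dots> \<le> card (F - spanned n \<A>) + card X" by (rule card_Un_le)
  finally show ?thesis .
qed

text \<open>Passage from an approximate to an exact statement. Diversity forces \<open>F\<close> to fill more than \<open>3 / 4\<close> of
the coset of \<open>T - {y}\<close> for at least three cells \<open>y\<close>. A permutation that meets \<open>T - {y}\<close> in fewer than \<open>t\<close>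
cells would have to be met elsewhere by all these members of \<open>F\<close>, but at most \<open>3 / 4\<close> of the coset do so.
Hence every member of \<open>G\<close> meets the three sets \<open>T - {y}\<close> in \<open>t\<close> cells each. If it contained only \<open>t\<close>
cells of \<open>T\<close>, it would miss all three cells \<open>y\<close>, while only two cells are missing.\<close>
lemma transversal_of_dense_cosets:
  fixes n t :: nat
  assumes t: "t \<ge> 2" and n: "n \<ge> 400 * t"
    and F: "F \<subseteq> Sym n" and G: "G \<subseteq> Sym n" and cr: "cross_intersecting n t F G"
    and div: "t * (fact (n - t - 1) - fact (n - t - 2)) \<le> diversity n t F"
    and e: "real (card (F - spanned n \<A>)) \<le> real (t * (fact (n - t - 1) - fact (n - t - 2))) / 5"
    and \<A>: "\<And>A. A \<in> \<A> \<Longrightarrow> A \<subseteq> T \<and> card A = t + 1"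
    and T: "T \<subseteq> {1..n} \<times> {1..n}" "card T = t + 2"
  shows "G \<subseteq> near_family n (t + 1) T"
proof -
  define D where "D = t * (fact (n - t - 1) - fact (n - t - 2) :: nat)"
  note ar = threshold_arith[OF t n, folded D_def]
  note div = div[folded D_def] and e = e[folded D_def]
  have fT: "finite T" using T finite_subset by blast
  define big where "big y \<longleftrightarrow> 3 / 4 * fact (n - t - 1) < real (card (F \<inter> coset n (T - {y})))" for y
  have ex: "\<exists>y\<in>S. big y" if S: "S \<subseteq> T" "card S = t" for S
  proof (rule ccontr)
    assume "\<not> (\<exists>y\<in>S. big y)"
    hence nb: "real (card (F \<inter> coset n (T - {y}))) \<le> 3 / 4 * fact (n - t - 1)" if "y \<in> S" for y
      using that by (auto simp: big_def not_less)
    have fS: "finite S" using S fT finite_subset by blast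
    let ?X = "\<Union>y\<in>S. F \<inter> coset n (T - {y})"
    have sub: "{\<sigma> \<in> F. \<not> S \<subseteq> perm_graph n \<sigma>} \<subseteq> (F - spanned n \<A>) \<union> ?X"
    proof
      fix \<sigma> assume s: "\<sigma> \<in> {\<sigma> \<in> F. \<not> S \<subseteq> perm_graph n \<sigma>}"
      show "\<sigma> \<in> (F - spanned n \<A>) \<union> ?X"
      proof (cases "\<sigma> \<in> spanned n \<A>")
        case True
        then obtain A where A: "A \<in> \<A>" "\<sigma> \<in> coset n A" by (auto simp: spanned_def)
        obtain y where y: "y \<in> S" "y \<notin> perm_graph n \<sigma>" using s by blast
        have "A = T - {y}"
        proof (rule card_subset_eq)
          show "A \<subseteq> T - {y}" using \<A>[OF A(1)] A(2) y by (auto simp: coset_def)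
          show "card A = card (T - {y})" using \<A>[OF A(1)] fT T(2) y(1) S(1) by auto
        qed (use fT in simp)
        thus ?thesis using A y s by blast
      qed (use s in blast)
    qed
    have "D \<le> card (F - spanned n \<A>) + card ?X"
      by (rule missing_bound[OF F _ S(2) div sub]) (use S T fS finite_coset in auto)
    moreover have "real (card ?X) \<le> real t * (3 / 4 * fact (n - t - 1))"
    proof -
      have "card ?X \<le> (\<Sum>y\<in>S. card (F \<inter> coset n (T - {y})))" by (rule card_UN_le[OF fS])
      hence "real (card ?X) \<le> (\<Sum>y\<in>S. real (card (F \<inter> coset n (T - {y}))))"
        by (simp only: of_nat_sum[symmetric] of_nat_le_iff)
      also have "\<dots> \<le> (\<Sum>y\<in>S. 3 / 4 * fact (n - t - 1))" by (rule sum_mono) (rule nb)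
      also have "\<dots> = real t * (3 / 4 * fact (n - t - 1))" using S by simp
      finally show ?thesis .
    qed
    ultimately have "real D \<le> real D / 5 + real t * (3 / 4 * fact (n - t - 1))" using e by linarith
    thus False using ar(3) by linarith
  qed
  have ex': "\<exists>y\<in>T. y \<noteq> a \<and> y \<noteq> b \<and> big y" if ab: "a \<in> T" "b \<in> T" "a \<noteq> b" for a b
  proof -
    have "card (T - {a, b}) = t" using ab T(2) fT by simp
    from ex[OF _ this] show ?thesis by blast
  qed
  have meet: "t \<le> card ((T - {y}) \<inter> perm_graph n \<tau>)" if y: "y \<in> T" "big y" and \<tau>: "\<tau> \<in> G" for y \<tau>
  proof (rule ccontr)
    assume "\<not> t \<le> card ((T - {y}) \<inter> perm_graph n \<tau>)"
    hence lt: "card ((T - {y}) \<inter> perm_graph n \<tau>) < t" by simp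
    let ?A = "T - {y}"
    have cA: "card ?A = t + 1" using y T(2) fT by simp
    let ?H = "{\<sigma> \<in> avoiding_coset n ?A {}. \<exists>i\<in>{1..n} - fst ` ?A. \<sigma> i = \<tau> i}"
    have "F \<inter> coset n ?A \<subseteq> ?H"
    proof
      fix \<sigma> assume s: "\<sigma> \<in> F \<inter> coset n ?A"
      have "t \<le> card (perm_graph n \<sigma> \<inter> perm_graph n \<tau>)"
        using cr s \<tau> by (auto simp: cross_intersecting_def card_perm_graph_Int)
      moreover have "?A \<subseteq> perm_graph n \<sigma>" using s by (auto simp: coset_def)
      ultimately have "\<exists>i\<in>{1..n} - fst ` ?A. \<sigma> i = \<tau> i"
        using agreement_outside[OF _ _ lt] fT by blast
      thus "\<sigma> \<in> ?H" using s by (auto simp: avoiding_coset_def)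
    qed
    hence "card (F \<inter> coset n ?A) \<le> card ?H"
      by (rule card_mono[rotated]) (use finite_avoiding in auto)
    moreover have "real (card ?H) \<le> 3 / 4 * card (avoiding_coset n ?A {})"
      by (rule card_hitting_le[where s = 0])
         (use \<tau> G cA t n in \<open>auto simp: line_bounded_def\<close>)
    moreover have "real (card (avoiding_coset n ?A {})) \<le> fact (n - t - 1)"
    proof -
      have "avoiding_coset n ?A {} = coset n ?A" by (auto simp: avoiding_coset_def)
      hence "card (avoiding_coset n ?A {}) \<le> fact (n - t - 1)"
        using card_coset_le[of n ?A] cA by (simp add: diff_diff_left)
      hence "real (card (avoiding_coset n ?A {})) \<le> real (fact (n - t - 1))" by (simp only: of_nat_le_iff)
      thus ?thesis by (simp only: of_nat_fact)
    qed
    ultimately have "real (card (F \<inter> coset n ?A)) \<le> 3 / 4 * fact (n - t - 1)" by linarith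
    thus False using y(2) by (simp add: big_def)
  qed
  obtain y1 where y1: "y1 \<in> T" "big y1"
  proof -
    obtain S where "S \<subseteq> T" "card S = t" using obtain_subset_with_card_n[of t T] T by auto
    thus thesis using ex that by blast
  qed
  have "T \<noteq> {y1}" using T(2) by auto
  then obtain z where z: "z \<in> T" "z \<noteq> y1" using y1 by blast
  obtain y2 where y2: "y2 \<in> T" "y2 \<noteq> y1" "big y2" using ex'[OF y1(1) z(1)] z(2) by metis
  obtain y3 where y3: "y3 \<in> T" "y3 \<noteq> y1" "y3 \<noteq> y2" "big y3" using ex'[OF y1(1) y2(1)] y2(2) by metis
  show ?thesis
  proof
    fix \<tau> assume \<tau>: "\<tau> \<in> G"
    have "t + 1 \<le> card (T \<inter> perm_graph n \<tau>)"
    proof (rule ccontr)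
      assume "\<not> t + 1 \<le> card (T \<inter> perm_graph n \<tau>)"
      hence le: "card (T \<inter> perm_graph n \<tau>) \<le> t" by simp
      have fI: "finite (T \<inter> perm_graph n \<tau>)" using fT by simp
      have no: "y \<notin> perm_graph n \<tau>" if "y \<in> T" "big y" for y
      proof
        assume y: "y \<in> perm_graph n \<tau>"
        have "(T - {y}) \<inter> perm_graph n \<tau> \<subset> T \<inter> perm_graph n \<tau>" using y that by blast
        hence "card ((T - {y}) \<inter> perm_graph n \<tau>) < card (T \<inter> perm_graph n \<tau>)"
          by (rule psubset_card_mono[OF fI])
        thus False using meet[OF that \<tau>] le by linarith
      qed
      have "T \<inter> perm_graph n \<tau> \<subseteq> T - {y1, y2, y3}" using no y1 y2 y3 by blast
      hence "card (T \<inter> perm_graph n \<tau>) \<le> card (T - {y1, y2, y3})" by (rule card_mono[rotated]) (use fT in simp)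
      also have "card (T - {y1, y2, y3}) = card T - card {y1, y2, y3}"
        by (rule card_Diff_subset) (use y1 y2 y3 in auto)
      also have "\<dots> = t - 1" using y2 y3 T(2) by simp
      finally have "card (T \<inter> perm_graph n \<tau>) \<le> t - 1" .
      moreover have "t \<le> card (T \<inter> perm_graph n \<tau>)"
        using meet[OF y1 \<tau>] card_mono[OF fI, of "(T - {y1}) \<inter> perm_graph n \<tau>"] by fastforce
      ultimately show False using t by linarith
    qed
    thus "\<tau> \<in> near_family n (t + 1) T" using \<tau> G by (auto simp: near_family_def)
  qed
qed

text \<open>A cover of size \<open>t\<close> would be contained in every member of \<open>\<B>\<close>, so that almost all of \<open>G\<close> would lie in
a single \<open>t\<close>-coset.\<close>
lemma no_small_member:
  assumes t: "t \<ge> 1" and G: "G \<subseteq> Sym n" and D: "D \<le> diversity n t G"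
    and e: "card (G - spanned n \<B>) < D"
    and A: "A \<in> \<A>" "A \<in> partial_perms n" "card A \<le> t + 1" and cr: "cross_sets t \<A> \<B>"
    and \<B>: "\<B> \<noteq> {}"
  shows "card A = t + 1"
proof (rule ccontr)
  assume "card A \<noteq> t + 1"
  hence cA: "card A \<le> t" using A by simp
  have fA: "finite A" "A \<subseteq> {1..n} \<times> {1..n}" using partial_perm_finite[OF A(2)] by auto
  have AB: "A \<subseteq> B" "t \<le> card A" if "B \<in> \<B>" for B
  proof -
    have tc: "t \<le> card (A \<inter> B)" using cr A that by (auto simp: cross_sets_def)
    have "A \<inter> B = A" by (rule card_seteq[OF fA(1)]) (use cA tc in auto)
    thus "A \<subseteq> B" "t \<le> card A" using tc by auto
  qed
  have "card A = t" using AB(2) \<B> cA by fastforce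
  moreover have "{\<sigma> \<in> G. \<not> A \<subseteq> perm_graph n \<sigma>} \<subseteq> (G - spanned n \<B>) \<union> {}"
    using AB(1) by (auto simp: spanned_def coset_def)
  ultimately have "D \<le> card (G - spanned n \<B>) + card ({} :: (nat \<Rightarrow> nat) set)"
    by (intro missing_bound[OF G fA(2) _ D]) auto
  thus False using e by simp
qed

text \<open>A single \<open>(t + 1)\<close>-set accounts for at most \<open>(n - t - 1)!\<close> permutations, fewer than the diversity
requires outside the coset of \<open>S\<close>.\<close>
lemma twice_missed_if_diverse:
  assumes F: "F \<subseteq> Sym n" and D: "D \<le> diversity n t F"
    and e: "real (card (F - spanned n \<A>)) + fact (n - t - 1) < real D"
    and \<A>: "\<And>A. A \<in> \<A> \<Longrightarrow> card A = t + 1"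
  shows "twice_missed t ({1..n} \<times> {1..n}) \<A>"
  unfolding twice_missed_def
proof (intro allI impI, rule ccontr)
  fix S :: "(nat \<times> nat) set" assume S: "S \<subseteq> {1..n} \<times> {1..n}" "card S = t"
    and no: "\<not> (\<exists>A1\<in>\<A>. \<exists>A2\<in>\<A>. A1 \<noteq> A2 \<and> \<not> S \<subseteq> A1 \<and> \<not> S \<subseteq> A2)"
  obtain X where X: "finite X" "real (card X) \<le> fact (n - t - 1)"
    "\<And>A. A \<in> \<A> \<Longrightarrow> \<not> S \<subseteq> A \<Longrightarrow> coset n A \<subseteq> X"
  proof (cases "\<exists>A1\<in>\<A>. \<not> S \<subseteq> A1")
    case True
    then obtain A1 where A1: "A1 \<in> \<A>" "\<not> S \<subseteq> A1" by blast
    have "card (coset n A1) \<le> fact (n - t - 1)"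
      using card_coset_le[of n A1] \<A>[OF A1(1)] by (simp add: diff_diff_left)
    hence "real (card (coset n A1)) \<le> real (fact (n - t - 1))" by (simp only: of_nat_le_iff)
    hence "real (card (coset n A1)) \<le> fact (n - t - 1)" by (simp only: of_nat_fact)
    moreover have "coset n A \<subseteq> coset n A1" if "A \<in> \<A>" "\<not> S \<subseteq> A" for A
      using no A1 that by (metis order_refl)
    ultimately show thesis using that finite_coset by blast
  next
    case False
    show thesis by (rule that[of "{}"]) (use False in auto)
  qed
  have "{\<sigma> \<in> F. \<not> S \<subseteq> perm_graph n \<sigma>} \<subseteq> (F - spanned n \<A>) \<union> X"
  proof
    fix \<sigma> assume s: "\<sigma> \<in> {\<sigma> \<in> F. \<not> S \<subseteq> perm_graph n \<sigma>}"
    show "\<sigma> \<in> (F - spanned n \<A>) \<union> X"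
    proof (cases "\<sigma> \<in> spanned n \<A>")
      case True
      then obtain A where A: "A \<in> \<A>" "\<sigma> \<in> coset n A" by (auto simp: spanned_def)
      have "\<not> S \<subseteq> A" using A s by (auto simp: coset_def)
      thus ?thesis using X(3) A by blast
    qed (use s in blast)
  qed
  hence "D \<le> card (F - spanned n \<A>) + card X" by (rule missing_bound[OF F S D _ X(1)])
  hence "real D \<le> real (card (F - spanned n \<A>)) + real (card X)" by linarith
  thus False using e X(2) by linarith
qed

lemma diverse_families_structure:
  fixes n t :: nat
  assumes t: "t \<ge> 2" and n: "n \<ge> 400 * t"
    and F: "F \<subseteq> Sym n" and G: "G \<subseteq> Sym n" and cr: "cross_intersecting n t F G"
    and dF: "t * (fact (n - t - 1) - fact (n - t - 2)) \<le> diversity n t F"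
    and dG: "t * (fact (n - t - 1) - fact (n - t - 2)) \<le> diversity n t G"
  obtains T where "T \<in> partial_perms n" "card T = t + 2"
    "F \<subseteq> near_family n (t + 1) T" "G \<subseteq> near_family n (t + 1) T"
proof -
  define D where "D = t * (fact (n - t - 1) - fact (n - t - 2) :: nat)"
  define k where "k = n div 10"
  let ?U = "{1..n} \<times> {1..n}"
  note ar = threshold_arith[OF t n, folded D_def]
  define e0 where "e0 = real ((n choose t) * fact (n - t)) * (3 / 4) ^ k"
  define s where "s = (\<Sum>j\<in>{2..k}. peel_cost n t j)"
  have e0: "e0 \<le> real D / 10" using uncovered_bound[OF t n] by (simp add: e0_def k_def D_def)
  have s: "real s \<le> real D / 10" using peel_bound[OF t n] unfolding s_def k_def D_def by simp
  have k10: "10 * k \<le> n" "k \<ge> 1" using n t by (auto simp: k_def)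
  have k: "t + 9 * k \<le> n + 5" "t + k + 5 \<le> n"
    using k10 n t by linarith+
  obtain \<A>0 \<B>0 where 0: "\<A>0 \<subseteq> partial_perms n" "\<B>0 \<subseteq> partial_perms n" "cross_sets t \<A>0 \<B>0"
    "\<And>A. A \<in> \<A>0 \<Longrightarrow> card A \<le> t + k" "\<And>B. B \<in> \<B>0 \<Longrightarrow> card B \<le> t + k"
    "card (F - spanned n \<A>0) \<le> e0" "card (G - spanned n \<B>0) \<le> e0"
    using approximate_both[OF F G cr k] unfolding e0_def by metis
  have big: "real D \<le> card F" "real D \<le> card G"
    using dF dG unfolding D_def[symmetric] diversity_def by linarith+
  have small: "e0 + real s < real D" using e0 s ar(1) by simp
  have bF: "e0 + real s < card F" and bG: "e0 + real s < card G" using big small by linarith+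
  obtain \<A> \<B> where *: "\<A> \<subseteq> partial_perms n" "\<B> \<subseteq> partial_perms n" "cross_sets t \<A> \<B>"
    "\<And>A. A \<in> \<A> \<Longrightarrow> card A \<le> t + 1" "\<And>B. B \<in> \<B> \<Longrightarrow> card B \<le> t + 1"
    "card (F - spanned n \<A>) \<le> e0 + real s" "card (G - spanned n \<B>) \<le> e0 + real s"
    using peel[OF F G 0(1,4) 0(2,5) 0(3) 0(6,7) bF[unfolded s_def] bG[unfolded s_def] k10(2)]
    unfolding s_def by metis
  have eF: "real (card (F - spanned n \<A>)) \<le> real D / 5" and eG: "real (card (G - spanned n \<B>)) \<le> real D / 5"
    using *(6,7) e0 s by linarith+
  have neA: "\<A> \<noteq> {}" using *(6) bF by (auto simp: spanned_def)
  have neB: "\<B> \<noteq> {}" using *(7) bG by (auto simp: spanned_def)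
  have crs: "cross_sets t \<B> \<A>" using *(3) cross_sets_sym by blast
  have t1: "t \<ge> 1" using t by simp
  have eF': "card (F - spanned n \<A>) < D" and eG': "card (G - spanned n \<B>) < D"
    using eF eG ar(1) by linarith+
  have cA: "card A = t + 1" if "A \<in> \<A>" for A
    by (rule no_small_member[OF t1 G _ eG' that _ _ *(3) neB]) (use dG * that in \<open>auto simp: D_def\<close>)
  have cB: "card B = t + 1" if "B \<in> \<B>" for B
    by (rule no_small_member[OF t1 F _ eF' that _ _ crs neA]) (use dF * that in \<open>auto simp: D_def\<close>)
  have tA: "twice_missed t ?U \<A>"
    by (rule twice_missed_if_diverse[OF F dF[folded D_def] _ cA]) (use eF ar(2) in linarith)
  have tB: "twice_missed t ?U \<B>"
    by (rule twice_missed_if_diverse[OF G dG[folded D_def] _ cB]) (use eG ar(2) in linarith)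
  have uA: "A \<subseteq> ?U \<and> card A = t + 1" if "A \<in> \<A>" for A
    using cA[OF that] partial_perm_finite[of A n] *(1) that by blast
  have uB: "B \<subseteq> ?U \<and> card B = t + 1" if "B \<in> \<B>" for B
    using cB[OF that] partial_perm_finite[of B n] *(2) that by blast
  have fU: "finite ?U" by simp
  obtain T where T: "T \<subseteq> ?U" "card T = t + 2" "\<And>A. A \<in> \<A> \<Longrightarrow> A \<subseteq> T" "\<And>B. B \<in> \<B> \<Longrightarrow> B \<subseteq> T"
    using confined_to_core[OF uA uB fU *(3) neA t1 tA tB] by metis
  have fT: "finite T" using T(1) fU finite_subset by blast
  \<comment> \<open>Any two cells of \<open>T\<close> lie in a common member of \<open>\<A>\<close>, which is part of a permutation.\<close>
  have pair: "fst u \<noteq> fst v \<and> snd u \<noteq> snd v" if uv: "u \<in> T" "v \<in> T" "u \<noteq> v" for u v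
  proof -
    have "card (T - {u, v}) = t" using uv T(2) fT by simp
    moreover have "T - {u, v} \<subseteq> ?U" using T(1) by blast
    ultimately obtain A where A: "A \<in> \<A>" "\<not> T - {u, v} \<subseteq> A" using twice_missedE[OF tA] by metis
    then obtain y where y: "y \<in> T - {u, v}" "y \<notin> A" by blast
    have "A = T - {y}"
    proof (rule card_subset_eq)
      show "A \<subseteq> T - {y}" using T(3)[OF A(1)] y by blast
      show "card A = card (T - {y})" using cA[OF A(1)] fT T(2) y by auto
    qed (use fT in simp)
    hence "u \<in> A" "v \<in> A" using uv y by auto
    moreover obtain \<sigma> where \<sigma>: "\<sigma> permutes {1..n}" "A \<subseteq> perm_graph n \<sigma>"
      using A(1) *(1) by (auto simp: partial_perms_def coset_def Sym_def)
    ultimately have "snd u = \<sigma> (fst u)" "snd v = \<sigma> (fst v)" by (auto simp: perm_graph_def)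
    thus ?thesis using uv(3) permutes_inj[OF \<sigma>(1)] by (metis injD prod_eqI)
  qed
  have Tp: "T \<in> partial_perms n"
    by (rule partial_perm_criterion[OF T(1)]) (rule inj_onI, metis pair)+
  have GT: "G \<subseteq> near_family n (t + 1) T"
    by (rule transversal_of_dense_cosets[OF t n F G cr dF eF[unfolded D_def] _ T(1,2)]) (use T cA in auto)
  have FT: "F \<subseteq> near_family n (t + 1) T"
  proof -
    have "cross_intersecting n t G F"
      unfolding cross_intersecting_def
    proof (intro ballI)
      fix \<tau> \<sigma> assume "\<tau> \<in> G" "\<sigma> \<in> F"
      hence "t \<le> card {i \<in> {1..n}. \<sigma> i = \<tau> i}" using cr by (simp add: cross_intersecting_def)
      moreover have "{i \<in> {1..n}. \<tau> i = \<sigma> i} = {i \<in> {1..n}. \<sigma> i = \<tau> i}" by auto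
      ultimately show "t \<le> card {i \<in> {1..n}. \<tau> i = \<sigma> i}" by (simp only:)
    qed
    thus ?thesis
      by (rule transversal_of_dense_cosets[OF t n G F _ dG eG[unfolded D_def] _ T(1,2)]) (use T cB in auto)
  qed
  show thesis by (rule that[OF Tp T(2) FT GT])
qed

theorem theorem1p7:
  fixes n t :: nat and F G :: "(nat \<Rightarrow> nat) set"
  assumes "t \<ge> 2" and "n \<ge> 400 * t"
    and "F \<subseteq> Sym n" and "G \<subseteq> Sym n"
    and "cross_intersecting n t F G"
  shows "min (diversity n t F) (diversity n t G)
           \<le> t * (fact (n - t - 1) - fact (n - t - 2)) \<and>
         (min (diversity n t F) (diversity n t G)
             = t * (fact (n - t - 1) - fact (n - t - 2)) \<longrightarrow>
           (\<exists>H. H \<subseteq> Sym n \<and> isomorphic_families n H (F1 n t) \<and> F \<subseteq> H \<and> G \<subseteq> H))"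
proof (cases "t * (fact (n - t - 1) - fact (n - t - 2)) \<le> min (diversity n t F) (diversity n t G)")
  case True
  then obtain T where T: "T \<in> partial_perms n" "card T = t + 2"
    "F \<subseteq> near_family n (t + 1) T" "G \<subseteq> near_family n (t + 1) T"
    using diverse_families_structure[OF assms] by auto
  have "diversity n t F \<le> t * (fact (n - t - 1) - fact (n - t - 2))"
    by (rule near_family_diversity[OF T(1,2,3)])
  moreover have "near_family n (t + 1) T \<subseteq> Sym n" by (auto simp: near_family_def)
  ultimately show ?thesis using T near_family_isomorphic[OF T(1,2)] by (meson min.coboundedI1)
next
  case False
  hence lt: "min (diversity n t F) (diversity n t G) < t * (fact (n - t - 1) - fact (n - t - 2))"
    by (rule not_le_imp_less)
  show ?thesis using less_imp_le[OF lt] less_imp_neq[OF lt] by blast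
qed

end
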